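(* Let $k\ge 3$ be an integer and let $r>-1$ be a real number. Then for every $\varepsilon>0$, as $x\to\infty$, $$\sum_{n_1,\ldots,n_k\le x}[n_1,\ldots,n_k]^r=C_{r,k}\,\frac{x^{k(r+1)}}{(r+1)^k}+O\left(x^{k(r+1)-\frac12\min(r+1,1)+\varepsilon}\right),$$ and $$\sum_{n_1,\ldots,n_k\le x}\left(\frac{[n_1,\ldots,n_k]}{n_1\cdots n_k}\right)^r=C_{r,k}\,x^k+O\left(x^{k-\frac12\min(r+1,1)+\varepsilon}\right),$$ where $$C_{r,k}=\prod_p\left(1-\frac1p\right)^k\sum_{\nu_1,\ldots,\nu_k=0}^{\infty}\frac{p^{r\max(\nu_1,\ldots,\nu_k)}}{p^{(r+1)(\nu_1+\cdots+\nu_k)}}.$$ In particular, $$C_{r,3}=\zeta(r+2)\zeta(2r+3)\prod_p\left(1-\frac{3}{p^2}+\frac{2}{p^3}+\frac{2}{p^{r+2}}-\frac{3}{p^{r+3}}+\frac{1}{p^{r+5}}\right),$$ and $$C_{r,4}=\zeta(r+2)\zeta(2r+3)\zeta(3r+4)\prod_p\Big(1-\frac{6}{p^2}+\frac{8}{p^3}-\frac{3}{p^4}+\frac{5}{p^{r+2}}-\frac{12}{p^{r+3}}+\frac{6}{p^{r+4}}+\frac{4}{p^{r+5}}-\frac{3}{p^{r+6}}+\frac{3}{p^{2r+3}}-\frac{4}{p^{2r+4}}-\frac{6}{p^{2r+5}}+\frac{12}{p^{2r+6}}-\frac{5}{p^{2r+7}}+\frac{3}{p^{3r+5}}-\frac{8}{p^{3r+6}}+\frac{6}{p^{3r+7}}-\frac{1}{p^{3r+9}}\Big).$$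 All products are over all primes $p$.
   Context: $[n_1,\ldots,n_k]$ denotes the least common multiple of the positive integers $n_1,\ldots,n_k$; sums over $n_1,\ldots,n_k\le x$ run over all $k$-tuples of positive integers each at most $x$. $\zeta$ is the Riemann zeta function. Implied constants may depend on $k$, $r$, $\varepsilon$. *)

theory Defs
  imports
    "HOL-Analysis.Analysis"
    "HOL-Computational_Algebra.Primes"
    "HOL-Library.Landau_Symbols"
    "HOL-Library.FuncSet"
begin

definition tuples_upto :: "nat \<Rightarrow> real \<Rightarrow> (nat \<Rightarrow> nat) set" where
  "tuples_upto k x = {1..k} \<rightarrow>\<^sub>E {n. 0 < n \<and> real n \<le> x}"

definition lcm_tuple :: "nat \<Rightarrow> (nat \<Rightarrow> nat) \<Rightarrow> nat" where
  "lcm_tuple k n = (LCM i\<in>{1..k}. n i)"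

text \<open>
  The Riemann zeta function on the real half-line \<open>s > 1\<close>, where it is given by its Dirichlet
  series. Only such arguments are used: \<open>r > -1\<close> gives \<open>r + 2 > 1\<close>,
  \<open>2r + 3 > 1\<close> and \<open>3r + 4 > 1\<close>.
\<close>
definition zeta :: "real \<Rightarrow> real" where
  "zeta s = (\<Sum>n. 1 / real (Suc n) powr s)"

text \<open>
  Infinite products over the primes, in increasing order, are infinite products over all natural
  numbers in which the factor at every non-prime is 1. Where the product does not converge,
  \<open>prime_prod\<close> is unspecified, so convergence has to be asserted separately.
\<close>
definition on_primes :: "(nat \<Rightarrow> real) \<Rightarrow> nat \<Rightarrow> real" where
  "on_primes f p = (if prime p then f p else 1)"

definition prime_prod_converges :: "(nat \<Rightarrow> real) \<Rightarrow> bool" where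
  "prime_prod_converges f \<longleftrightarrow> convergent_prod (on_primes f)"

definition prime_prod :: "(nat \<Rightarrow> real) \<Rightarrow> real" where
  "prime_prod f = prodinf (on_primes f)"

definition local_term :: "real \<Rightarrow> nat \<Rightarrow> nat \<Rightarrow> (nat \<Rightarrow> nat) \<Rightarrow> real" where
  "local_term r k p \<nu> =
     real p powr (r * real (MAX i\<in>{1..k}. \<nu> i)) / real p powr ((r + 1) * real (\<Sum>i=1..k. \<nu> i))"

definition local_factor :: "real \<Rightarrow> nat \<Rightarrow> nat \<Rightarrow> real" where
  "local_factor r k p =
     (1 - 1 / real p) ^ k * (\<Sum>\<^sub>\<infinity>\<nu>\<in>{1..k} \<rightarrow>\<^sub>E UNIV. local_term r k p \<nu>)"

definition C :: "real \<Rightarrow> nat \<Rightarrow> real" where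
  "C r k = prime_prod (local_factor r k)"

definition factor3 :: "real \<Rightarrow> nat \<Rightarrow> real" where
  "factor3 r p =
     1 - 3 / real p ^ 2 + 2 / real p ^ 3
       + 2 / real p powr (r + 2) - 3 / real p powr (r + 3) + 1 / real p powr (r + 5)"

definition factor4 :: "real \<Rightarrow> nat \<Rightarrow> real" where
  "factor4 r p =
     1 - 6 / real p ^ 2 + 8 / real p ^ 3 - 3 / real p ^ 4
       + 5 / real p powr (r + 2) - 12 / real p powr (r + 3) + 6 / real p powr (r + 4)
       + 4 / real p powr (r + 5) - 3 / real p powr (r + 6)
       + 3 / real p powr (2 * r + 3) - 4 / real p powr (2 * r + 4) - 6 / real p powr (2 * r + 5)
       + 12 / real p powr (2 * r + 6) - 5 / real p powr (2 * r + 7)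
       + 3 / real p powr (3 * r + 5) - 8 / real p powr (3 * r + 6) + 6 / real p powr (3 * r + 7)
       - 1 / real p powr (3 * r + 9)"

end

theory Submission
  imports Defs
begin

text \<open>
  Write \<open>f(n) = ([n]/\<Prod>n\<^sub>i)\<^sup>r\<close>. This function is multiplicative in \<open>k\<close> variables, with value \<open>p\<close> to the power
  \<open>-r (\<Sum>\<nu> - max \<nu>)\<close> at the prime \<open>p\<close>, and it is the convolution of the constant 1 with a multiplicative
  \<open>g\<close> that is locally the mixed difference of \<open>f\<close>. Since \<open>f\<close> is 1 on prime powers in a single variable,
  \<open>g\<close> vanishes at exponent vectors with exactly one nonzero entry, so that
  \<open>\<Sum>\<^sub>d |g(d)| d\<^sub>j powr \<beta> / \<Prod>d\<^sub>i\<close> converges for \<open>\<beta> < min(r + 1, 1)\<close>. Both sums of the theorem have the form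
  \<open>\<Sum>f(n) \<Prod>n\<^sub>i powr t\<close>, with \<open>t = r\<close> or \<open>t = 0\<close>, and hence equal
  \<open>\<Sum>\<^sub>d g(d) \<Prod>d\<^sub>i powr t T(x/d\<^sub>i)\<close>, where \<open>T(y) = \<Sum>\<^sub>m\<^sub>\<le>\<^sub>y m powr t\<close> differs from \<open>y powr (t+1)/(t+1)\<close> by
  \<open>O(y powr (t+1-\<beta>))\<close> for all \<open>y > 0\<close>. Taking \<open>\<beta> = min(r + 1, 1)/2\<close> gives both asymptotic formulas,
  even with \<open>\<epsilon> = 0\<close>.

  To keep all sums finite, exponents are truncated at \<open>M\<close> and primes at \<open>N\<close>. This is harmless for
  fixed \<open>x\<close> if \<open>M \<ge> N \<ge> x\<close>, and the error bound is uniform, so that \<open>M \<longlongrightarrow> \<infinity>\<close> and then \<open>N \<longlongrightarrow> \<infinity>\<close> produce the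
  constant \<open>C\<close>. For the closed forms, the series over exponent vectors is summed according to the value
  of the maximum.
\<close>

section \<open>Mixed differences on exponent vectors\<close>

definition exps :: "nat \<Rightarrow> nat \<Rightarrow> (nat \<Rightarrow> nat) set" where
  "exps k M = {1..k} \<rightarrow>\<^sub>E {..M}"

text \<open>The Moebius function at \<open>p ^ (b - a)\<close>: as a matrix, the inverse of
  \<open>of_bool (a \<le> b)\<close>.\<close>

definition kern :: "nat \<Rightarrow> nat \<Rightarrow> real" where
  "kern a b = (if a = b then 1 else if Suc a = b then -1 else 0)"

text \<open>Moebius inversion in all coordinates at once. For \<open>\<mu>\<close> in the box every
  contributing \<open>\<kappa>\<close> lies in it too, so the value there does not depend on
  \<open>M\<close>.\<close>

definition mixed_diff :: "nat \<Rightarrow> nat \<Rightarrow> ((nat \<Rightarrow> nat) \<Rightarrow> real) \<Rightarrow> (nat \<Rightarrow> nat) \<Rightarrow> real" where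
  "mixed_diff k M f \<mu> = (\<Sum>\<kappa>\<in>exps k M. f \<kappa> * (\<Prod>i=1..k. kern (\<kappa> i) (\<mu> i)))"

text \<open>If \<open>\<nu> i\<close> is the exponent of a prime in the \<open>i\<close>-th number,
  this is its exponent in the product divided by the least common multiple. For
  \<open>k \<ge> 1\<close> the subtraction in \<open>nat\<close> is exact.\<close>

definition excess :: "nat \<Rightarrow> (nat \<Rightarrow> nat) \<Rightarrow> nat" where
  "excess k \<nu> = (\<Sum>i=1..k. \<nu> i) - (MAX i\<in>{1..k}. \<nu> i)"

lemma finite_exps [simp]: "finite (exps k M)"
  by (auto simp: exps_def intro: finite_PiE)

lemma exps_le: "\<mu> \<in> exps k M \<Longrightarrow> i \<in> {1..k} \<Longrightarrow> \<mu> i \<le> M"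
  by (auto simp: exps_def PiE_iff)

lemma sum_exps_prod:
  fixes f :: "nat \<Rightarrow> nat \<Rightarrow> real"
  shows "(\<Sum>\<mu>\<in>exps k M. \<Prod>i=1..k. f i (\<mu> i)) = (\<Prod>i=1..k. \<Sum>a\<le>M. f i a)"
  unfolding exps_def by (rule prod_sum_PiE [symmetric]) auto

lemma kern_eq: "kern a b = of_bool (b = a) - of_bool (b = Suc a)"
  by (auto simp: kern_def)

text \<open>A row of \<open>kern\<close> has the entry 1 on the diagonal, followed by -1; for
  \<open>a = M\<close> the second entry falls outside the box.\<close>

lemma sum_kern_right:
  assumes "a \<le> M"
  shows "(\<Sum>b\<le>M. kern a b * h b) = h a - of_bool (a < M) * h (Suc a)"
proof -
  have "(\<Sum>b\<le>M. kern a b * h b) = (\<Sum>b\<le>M. if b = a then h b else 0) - (\<Sum>b\<le>M. if b = Suc a then h b else 0)"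
    unfolding sum_subtractf [symmetric] by (intro sum.cong) (auto simp: kern_eq)
  also have "\<dots> = h a - of_bool (a < M) * h (Suc a)"
    using assms by (auto simp: sum.delta')
  finally show ?thesis .
qed

text \<open>The entries 1 and -1 of a column cancel, except that column 0 lacks the -1.\<close>

lemma sum_kern_left:
  assumes "b \<le> M"
  shows "(\<Sum>a\<le>M. kern a b) = of_bool (b = 0)"
proof (cases b)
  case 0
  then have "(\<Sum>a\<le>M. kern a b) = (\<Sum>a\<le>M. if a = 0 then 1 else 0)"
    by (intro sum.cong) (auto simp: kern_def)
  with 0 show ?thesis by simp
next
  case (Suc c)
  have "(\<Sum>a\<le>M. kern a b) = (\<Sum>a\<le>M. if a = b then 1 else 0) - (\<Sum>a\<le>M. if a = c then 1 else 0)"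
    unfolding sum_subtractf [symmetric] using Suc by (intro sum.cong) (auto simp: kern_def)
  with Suc assms show ?thesis by simp
qed

lemma sum_abs_kern_left: "(\<Sum>a\<le>M. \<bar>kern a b\<bar>) \<le> 2"
proof -
  \<comment> \<open>For \<open>b = 0\<close> both indicators pick \<open>a = 0\<close>, because
    \<open>b - 1\<close> is 0 in \<open>nat\<close>; this only enlarges the right side.\<close>
  have "(\<Sum>a\<le>M. \<bar>kern a b\<bar>) \<le> (\<Sum>a\<le>M. (if a = b then 1 else 0) + (if a = b - 1 then 1 else 0))"
    by (intro sum_mono) (auto simp: kern_def)
  also have "\<dots> \<le> 2" by (simp add: sum.distrib)
  finally show ?thesis .
qed

lemma prod_of_bool:
  "finite A \<Longrightarrow> (\<Prod>i\<in>A. of_bool (P i)) = (of_bool (\<forall>i\<in>A. P i) :: real)"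
  by (induction rule: finite_induct) auto

text \<open>After swapping the sums, the sum over \<open>\<mu>\<close> factors over the coordinates,
  and each factor collapses to the indicator of \<open>\<kappa> i = \<nu> i\<close>.\<close>

lemma mixed_diff_inversion:
  assumes "\<nu> \<in> exps k M"
  shows "(\<Sum>\<mu>\<in>exps k M. mixed_diff k M f \<mu> * (\<Prod>i=1..k. of_bool (\<mu> i \<le> \<nu> i))) = f \<nu>"
proof -
  have "(\<Sum>\<mu>\<in>exps k M. mixed_diff k M f \<mu> * (\<Prod>i=1..k. of_bool (\<mu> i \<le> \<nu> i))) =
     (\<Sum>\<mu>\<in>exps k M. \<Sum>\<kappa>\<in>exps k M. f \<kappa> * (\<Prod>i=1..k. kern (\<kappa> i) (\<mu> i) * of_bool (\<mu> i \<le> \<nu> i)))"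
    unfolding mixed_diff_def sum_distrib_right prod.distrib mult.assoc ..
  also have "\<dots> = (\<Sum>\<kappa>\<in>exps k M. f \<kappa> * (\<Sum>\<mu>\<in>exps k M. \<Prod>i=1..k. kern (\<kappa> i) (\<mu> i) * of_bool (\<mu> i \<le> \<nu> i)))"
    unfolding sum_distrib_left by (rule sum.swap)
  also have "\<dots> = (\<Sum>\<kappa>\<in>exps k M. f \<kappa> * (\<Prod>i=1..k. \<Sum>b\<le>M. kern (\<kappa> i) b * of_bool (b \<le> \<nu> i)))"
    by (subst sum_exps_prod) simp
  also have "\<dots> = (\<Sum>\<kappa>\<in>exps k M. f \<kappa> * (\<Prod>i=1..k. of_bool (\<kappa> i = \<nu> i)))"
  proof (intro sum.cong refl arg_cong2[where f = "(*)"] prod.cong)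
    fix \<kappa> i assume *: "\<kappa> \<in> exps k M" "i \<in> {1..k}"
    \<comment> \<open>The truncation does no harm: \<open>Suc (\<kappa> i) \<le> \<nu> i\<close>
      already forces \<open>\<kappa> i < M\<close>.\<close>
    show "(\<Sum>b\<le>M. kern (\<kappa> i) b * of_bool (b \<le> \<nu> i)) = (of_bool (\<kappa> i = \<nu> i) :: real)"
      using exps_le[OF * ] exps_le[OF assms *(2)] by (subst sum_kern_right) (auto simp: of_bool_def)
  qed
  also have "\<dots> = (\<Sum>\<kappa>\<in>exps k M. if \<kappa> = \<nu> then f \<kappa> else 0)"
  proof (intro sum.cong refl)
    fix \<kappa> assume *: "\<kappa> \<in> exps k M"
    have "(\<forall>i\<in>{1..k}. \<kappa> i = \<nu> i) \<longleftrightarrow> \<kappa> = \<nu>"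
      using * assms by (auto simp: exps_def intro: PiE_ext)
    then show "f \<kappa> * (\<Prod>i=1..k. of_bool (\<kappa> i = \<nu> i)) = (if \<kappa> = \<nu> then f \<kappa> else 0)"
      by (simp add: prod_of_bool del: ball_simps)
  qed
  also have "\<dots> = f \<nu>" using assms by simp
  finally show ?thesis .
qed

lemma prod_kern_support:
  fixes \<kappa> :: "nat \<Rightarrow> nat"
  assumes "(\<Prod>i=1..k. kern (\<kappa> i) (\<mu> i)) \<noteq> 0" "i \<in> {1..k}"
  shows "\<kappa> i \<le> \<mu> i"
proof -
  from assms have "kern (\<kappa> i) (\<mu> i) \<noteq> 0" by (simp add: prod_zero_iff)
  then show ?thesis by (auto simp: kern_def split: if_splits)
qed

text \<open>In each coordinate only \<open>\<mu> i\<close> and its predecessor contribute, hence the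
  factor \<open>2 ^ k\<close> and a hypothesis on \<open>f\<close> below \<open>\<mu>\<close>
  alone.\<close>

lemma abs_mixed_diff_le:
  assumes "\<And>\<kappa>. \<forall>i\<in>{1..k}. \<kappa> i \<le> \<mu> i \<Longrightarrow> \<bar>f \<kappa>\<bar> \<le> B" "B \<ge> 0"
  shows "\<bar>mixed_diff k M f \<mu>\<bar> \<le> 2 ^ k * B"
proof -
  have "\<bar>mixed_diff k M f \<mu>\<bar> \<le> (\<Sum>\<kappa>\<in>exps k M. B * (\<Prod>i=1..k. \<bar>kern (\<kappa> i) (\<mu> i)\<bar>))"
    unfolding mixed_diff_def
  proof (intro order.trans[OF sum_abs] sum_mono)
    fix \<kappa>
    show "\<bar>f \<kappa> * (\<Prod>i=1..k. kern (\<kappa> i) (\<mu> i))\<bar> \<le> B * (\<Prod>i=1..k. \<bar>kern (\<kappa> i) (\<mu> i)\<bar>)"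
    proof (cases "(\<Prod>i=1..k. kern (\<kappa> i) (\<mu> i)) = 0")
      case True
      then show ?thesis unfolding True by (intro order.trans[OF _ mult_nonneg_nonneg[OF assms(2)]] prod_nonneg) auto
    next
      case False
      then have "\<bar>f \<kappa>\<bar> \<le> B" by (intro assms) (use prod_kern_support in blast)
      then show ?thesis unfolding abs_mult abs_prod
        by (intro mult_right_mono prod_nonneg) auto
    qed
  qed
  also have "\<dots> = B * (\<Prod>i=1..k. \<Sum>a\<le>M. \<bar>kern a (\<mu> i)\<bar>)"
    unfolding sum_distrib_left [symmetric] by (subst sum_exps_prod) simp
  also have "\<dots> \<le> B * (\<Prod>i=1..k. 2)"
    by (intro mult_left_mono prod_mono conjI sum_abs_kern_left sum_nonneg assms) auto
  finally show ?thesis by (simp add: mult.commute)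
qed

text \<open>With \<open>f\<close> replaced by 1 the sum factors into column sums of
  \<open>kern\<close>, which vanish outside column 0.\<close>

lemma mixed_diff_locally_one:
  assumes "\<And>\<kappa>. \<forall>i\<in>{1..k}. \<kappa> i \<le> \<mu> i \<Longrightarrow> f \<kappa> = 1" "\<mu> \<in> exps k M"
  shows "mixed_diff k M f \<mu> = of_bool (\<forall>i\<in>{1..k}. \<mu> i = 0)"
proof -
  have "mixed_diff k M f \<mu> = (\<Sum>\<kappa>\<in>exps k M. (\<Prod>i=1..k. kern (\<kappa> i) (\<mu> i)))"
    unfolding mixed_diff_def
  proof (intro sum.cong refl)
    fix \<kappa>
    show "f \<kappa> * (\<Prod>i=1..k. kern (\<kappa> i) (\<mu> i)) = (\<Prod>i=1..k. kern (\<kappa> i) (\<mu> i))"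
    proof (cases "(\<Prod>i=1..k. kern (\<kappa> i) (\<mu> i)) = 0")
      case False
      then have "f \<kappa> = 1" by (intro assms) (use prod_kern_support in blast)
      then show ?thesis by simp
    qed auto
  qed
  also have "\<dots> = (\<Prod>i=1..k. \<Sum>a\<le>M. kern a (\<mu> i))" by (rule sum_exps_prod)
  also have "\<dots> = (\<Prod>i=1..k. of_bool (\<mu> i = 0))"
    by (intro prod.cong refl sum_kern_left exps_le[OF assms(2)])
  finally show ?thesis by (simp add: prod_of_bool)
qed

text \<open>Summation by parts moves the difference from \<open>f\<close> to the powers of
  \<open>z\<close>. Each coordinate below the top layer yields a factor \<open>1 - z\<close>, the
  source of \<open>(1 - 1 / real p) ^ k\<close> in the constant; a coordinate equal to
  \<open>M\<close> yields none.\<close>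

lemma sum_mixed_diff_power:
  "(\<Sum>\<mu>\<in>exps k M. mixed_diff k M f \<mu> * (\<Prod>i=1..k. z ^ \<mu> i)) =
   (\<Sum>\<kappa>\<in>exps k M. f \<kappa> * (\<Prod>i=1..k. z ^ \<kappa> i * (1 - of_bool (\<kappa> i < M) * z)))"
proof -
  have "(\<Sum>\<mu>\<in>exps k M. mixed_diff k M f \<mu> * (\<Prod>i=1..k. z ^ \<mu> i)) =
     (\<Sum>\<mu>\<in>exps k M. \<Sum>\<kappa>\<in>exps k M. f \<kappa> * (\<Prod>i=1..k. kern (\<kappa> i) (\<mu> i) * z ^ \<mu> i))"
    unfolding mixed_diff_def sum_distrib_right prod.distrib mult.assoc ..
  also have "\<dots> = (\<Sum>\<kappa>\<in>exps k M. f \<kappa> * (\<Sum>\<mu>\<in>exps k M. \<Prod>i=1..k. kern (\<kappa> i) (\<mu> i) * z ^ \<mu> i))"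
    unfolding sum_distrib_left by (rule sum.swap)
  also have "\<dots> = (\<Sum>\<kappa>\<in>exps k M. f \<kappa> * (\<Prod>i=1..k. \<Sum>b\<le>M. kern (\<kappa> i) b * z ^ b))"
    by (subst sum_exps_prod) simp
  also have "\<dots> = (\<Sum>\<kappa>\<in>exps k M. f \<kappa> * (\<Prod>i=1..k. z ^ \<kappa> i * (1 - of_bool (\<kappa> i < M) * z)))"
    by (intro sum.cong refl arg_cong2[where f = "(*)"] prod.cong, subst sum_kern_right)
       (auto dest: exps_le simp: algebra_simps)
  finally show ?thesis .
qed

lemma Max_le_sum:
  fixes \<nu> :: "nat \<Rightarrow> nat"
  assumes "k \<ge> 1"
  shows "(MAX i\<in>{1..k}. \<nu> i) \<le> (\<Sum>i=1..k. \<nu> i)"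
  using assms by (intro Max.boundedI) (auto intro!: member_le_sum)

text \<open>The excess is the sum with one maximal entry left out. Leaving out the position
  \<open>j\<close> where \<open>\<mu>\<close> is maximal, instead of a maximal entry of
  \<open>\<kappa>\<close>, can only increase what remains of \<open>\<kappa>\<close>.\<close>

lemma excess_mono:
  assumes "k \<ge> 1" "\<forall>i\<in>{1..k}. \<kappa> i \<le> \<mu> i"
  shows "excess k \<kappa> \<le> excess k \<mu>"
proof -
  have "(MAX i\<in>{1..k}. \<mu> i) \<in> \<mu> ` {1..k}" using assms(1) by (intro Max_in) auto
  then obtain j where j: "j \<in> {1..k}" "(MAX i\<in>{1..k}. \<mu> i) = \<mu> j" by auto
  have "excess k \<kappa> \<le> (\<Sum>i=1..k. \<kappa> i) - \<kappa> j"
    unfolding excess_def using j by (intro diff_le_mono2 Max_ge) auto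
  also have "\<dots> = (\<Sum>i\<in>{1..k}-{j}. \<kappa> i)" using j by (subst sum_diff1_nat) auto
  also have "\<dots> \<le> (\<Sum>i\<in>{1..k}-{j}. \<mu> i)" using assms by (intro sum_mono) auto
  also have "\<dots> = excess k \<mu>" unfolding excess_def j(2) using j by (subst sum_diff1_nat) auto
  finally show ?thesis .
qed

section \<open>The local factors\<close>

definition local_weight :: "real \<Rightarrow> nat \<Rightarrow> nat \<Rightarrow> (nat \<Rightarrow> nat) \<Rightarrow> real" where
  "local_weight r k p \<nu> = real p powr (- r * real (excess k \<nu>))"

text \<open>The values of the convolution factor \<open>g\<close> at tuples of powers of
  \<open>p\<close>.\<close>

definition local_mob :: "real \<Rightarrow> nat \<Rightarrow> nat \<Rightarrow> nat \<Rightarrow> (nat \<Rightarrow> nat) \<Rightarrow> real" where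
  "local_mob r k p M = mixed_diff k M (local_weight r k p)"

text \<open>Half of the critical exponent \<open>min (r + 1) 1\<close>. An error term saving this
  power of \<open>x\<close> leaves local sums of size \<open>p powr - (1 + saving r)\<close>, still
  summable over the primes.\<close>

definition saving :: "real \<Rightarrow> real" where
  "saving r = min (r + 1) 1 / 2"

text \<open>\<open>2 ^ k\<close> bounds the mixed difference, the last power collects a geometric
  series for each coordinate, and \<open>2 powr (2 * saving r)\<close> pays for starting the decay
  at exponent sum 2.\<close>

definition local_const :: "real \<Rightarrow> nat \<Rightarrow> real" where
  "local_const r k = 2 ^ k * (2 powr (2 * saving r) * (1 / (1 - 2 powr - saving r)) ^ k)"

lemma saving_bounds:
  assumes "r > -1"
  shows "0 < saving r" "2 * saving r \<le> 1" "- r \<le> 1 - 2 * saving r"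
  using assms by (auto simp: saving_def min_def)

lemma excess_plus_Max:
  "k \<ge> 1 \<Longrightarrow> real (excess k \<nu>) + real (MAX i\<in>{1..k}. \<nu> i) = real (\<Sum>i=1..k. \<nu> i)"
  using Max_le_sum[of k \<nu>] by (simp add: excess_def)

lemma excess_le_sum: "excess k \<nu> \<le> (\<Sum>i=1..k. \<nu> i)"
  by (simp add: excess_def)

lemma prod_inverse_power:
  fixes \<nu> :: "nat \<Rightarrow> nat"
  assumes "p > 0"
  shows "(\<Prod>i=1..k. (1 / real p) ^ \<nu> i) = real p powr - real (\<Sum>i=1..k. \<nu> i)"
  using assms unfolding power_sum [symmetric]
  by (simp add: powr_minus powr_realpow power_one_over divide_inverse power_inverse del: of_nat_sum)

text \<open>Writing the maximum as sum minus excess shows that the series in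
  \<open>local_factor\<close> adds up \<open>f\<close> over tuples of powers of \<open>p\<close>,
  each divided by the product of its entries.\<close>

lemma local_term_eq:
  assumes "p > 0" "k \<ge> 1"
  shows "local_term r k p \<nu> = local_weight r k p \<nu> * (\<Prod>i=1..k. (1 / real p) ^ \<nu> i)"
proof -
  have "r * real (MAX i\<in>{1..k}. \<nu> i) - (r + 1) * real (\<Sum>i=1..k. \<nu> i)
      = - r * real (excess k \<nu>) + - real (\<Sum>i=1..k. \<nu> i)"
    unfolding excess_plus_Max[OF assms(2), symmetric] by (simp add: algebra_simps)
  then show ?thesis
    using assms unfolding local_term_def local_weight_def prod_inverse_power[OF assms(1)]
    by (metis powr_add powr_diff)
qed

text \<open>For negative \<open>r\<close> the weight grows with the excess. The exponent
  \<open>1 - 2 * saving r\<close> dominates \<open>- r\<close> and is nonnegative, so this majorant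
  is monotone and serves all \<open>\<kappa>\<close> below \<open>\<mu>\<close> at once.\<close>

lemma local_weight_le:
  assumes "r > -1" "k \<ge> 1" "p \<ge> 1" "\<forall>i\<in>{1..k}. \<kappa> i \<le> \<mu> i"
  shows "local_weight r k p \<kappa> \<le> real p powr ((1 - 2 * saving r) * real (excess k \<mu>))"
proof -
  have "- r * real (excess k \<kappa>) \<le> (1 - 2 * saving r) * real (excess k \<kappa>)"
    using saving_bounds[OF assms(1)] by (intro mult_right_mono) auto
  also have "\<dots> \<le> (1 - 2 * saving r) * real (excess k \<mu>)"
    using saving_bounds[OF assms(1)] excess_mono[OF assms(2,4)] by (intro mult_left_mono) auto
  finally show ?thesis
    unfolding local_weight_def using assms by (intro powr_mono) auto
qed

text \<open>Excess 0 is inherited by every vector below \<open>\<mu>\<close>, so the weight is 1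
  there and the difference is that of a constant. This covers vectors with a single nonzero
  entry.\<close>

lemma local_mob_eq_if_excess_0:
  assumes "k \<ge> 1" "p \<ge> 1" "excess k \<mu> = 0" "\<mu> \<in> exps k M"
  shows "local_mob r k p M \<mu> = of_bool (\<forall>i\<in>{1..k}. \<mu> i = 0)"
  unfolding local_mob_def
proof (rule mixed_diff_locally_one)
  fix \<kappa> assume "\<forall>i\<in>{1..k}. \<kappa> i \<le> \<mu> i"
  from excess_mono[OF assms(1) this] assms(3) have "excess k \<kappa> = 0" by simp
  then show "local_weight r k p \<kappa> = 1" using assms by (simp add: local_weight_def)
qed fact

text \<open>A nonzero value requires excess \<open>s \<ge> 1\<close> and maximum
  \<open>a \<ge> 1\<close>. Part of the resulting decay is kept as a power of \<open>p\<close>, for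
  the sum over primes; the rest is spread over the entries of \<open>\<mu>\<close>, for the sum over
  exponents.\<close>

lemma local_mob_bound:
  assumes r: "r > -1" and k: "k \<ge> 1" and p: "p \<ge> 2" and \<mu>: "\<mu> \<in> exps k M"
    and nz: "\<exists>i\<in>{1..k}. \<mu> i \<noteq> 0" and j: "j \<in> {1..k}" and \<beta>: "0 \<le> \<beta>" "\<beta> \<le> saving r"
  shows "\<bar>local_mob r k p M \<mu>\<bar> * (\<Prod>i=1..k. (1 / real p) ^ \<mu> i) * real p powr (\<beta> * real (\<mu> j))
    \<le> 2 ^ k * real p powr - (1 + saving r) *
       (2 powr (2 * saving r) * (\<Prod>i=1..k. (2 powr - saving r) ^ \<mu> i))"
proof (cases "excess k \<mu> = 0")
  case True
  have "local_mob r k p M \<mu> = 0"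
    using local_mob_eq_if_excess_0[OF k _ True \<mu>] nz p by auto
  then show ?thesis by (auto intro!: mult_nonneg_nonneg prod_nonneg)
next
  case False
  define s a S where "s = real (excess k \<mu>)" and "a = real (MAX i\<in>{1..k}. \<mu> i)"
    and "S = real (\<Sum>i=1..k. \<mu> i)"
  note sv = saving_bounds[OF r]
  have Ssa: "S = s + a" using excess_plus_Max[OF k, of \<mu>] by (simp add: s_def a_def S_def)
  have s1: "s \<ge> 1" using False by (simp add: s_def)
  have le_Max: "\<mu> i \<le> (MAX i\<in>{1..k}. \<mu> i)" if "i \<in> {1..k}" for i
    using that by (intro Max_ge) auto
  have a1: "a \<ge> 1"
  proof -
    from nz obtain i where "i \<in> {1..k}" "\<mu> i \<noteq> 0" by auto
    with le_Max[of i] show ?thesis unfolding a_def by linarith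
  qed
  have "\<beta> * real (\<mu> j) \<le> saving r * a"
    unfolding a_def using \<beta> le_Max[OF j] by (intro mult_mono) auto
  moreover have "saving r * 1 \<le> saving r * s" "(1 - 2 * saving r) * 1 \<le> (1 - 2 * saving r) * a"
    using s1 a1 sv by (intro mult_left_mono; simp)+
  \<comment> \<open>The constants are fitted to the extreme case \<open>s = a = 1\<close>;
    \<open>S - 2\<close> measures the distance from it.\<close>
  ultimately have expo: "(1 - 2 * saving r) * s + - S + \<beta> * real (\<mu> j)
      \<le> - (1 + saving r) + - saving r * (S - 2)"
    unfolding Ssa by (simp add: algebra_simps)
  have "\<bar>local_mob r k p M \<mu>\<bar> \<le> 2 ^ k * real p powr ((1 - 2 * saving r) * s)"
    unfolding local_mob_def s_def
  proof (rule abs_mixed_diff_le)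
    fix \<kappa> assume "\<forall>i\<in>{1..k}. \<kappa> i \<le> \<mu> i"
    from local_weight_le[OF r k _ this, of p] p
    show "\<bar>local_weight r k p \<kappa>\<bar> \<le> real p powr ((1 - 2 * saving r) * real (excess k \<mu>))"
      by (simp add: local_weight_def)
  qed auto
  then have "\<bar>local_mob r k p M \<mu>\<bar> * (\<Prod>i=1..k. (1 / real p) ^ \<mu> i) * real p powr (\<beta> * real (\<mu> j))
     \<le> 2 ^ k * real p powr ((1 - 2 * saving r) * s) * real p powr - S * real p powr (\<beta> * real (\<mu> j))"
    using p by (subst prod_inverse_power) (auto simp: S_def intro!: mult_right_mono)
  also have "\<dots> = 2 ^ k * real p powr ((1 - 2 * saving r) * s + - S + \<beta> * real (\<mu> j))"
    unfolding powr_add by simp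
  also have "\<dots> \<le> 2 ^ k * real p powr (- (1 + saving r) + - saving r * (S - 2))"
    using p expo by (intro mult_left_mono powr_mono) auto
  also have "\<dots> = 2 ^ k * real p powr - (1 + saving r) * real p powr (- saving r * (S - 2))"
    unfolding powr_add by simp
  \<comment> \<open>Since \<open>S \<ge> 2\<close>, the exponent is at most 0 and \<open>p\<close>
    may be lowered to 2; the decay in \<open>\<mu>\<close> becomes independent of
    \<open>p\<close>.\<close>
  also have "\<dots> \<le> 2 ^ k * real p powr - (1 + saving r) * 2 powr (- saving r * (S - 2))"
    using p sv s1 a1 Ssa by (intro mult_left_mono powr_mono2') (auto intro!: mult_nonneg_nonneg)
  also have "2 powr (- saving r * (S - 2)) = 2 powr (2 * saving r) * 2 powr (- saving r * S)"
    unfolding powr_add [symmetric] by (simp add: algebra_simps)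
  also have "2 powr (- saving r * S) = (\<Prod>i=1..k. (2 powr - saving r) ^ \<mu> i)"
    unfolding power_sum [symmetric] S_def
    by (subst powr_realpow [symmetric]) (simp_all add: powr_powr)
  finally show ?thesis .
qed

lemma sum_exps_power_le:
  assumes "0 \<le> c" "c < 1"
  shows "(\<Sum>\<mu>\<in>exps k M. \<Prod>i=1..k. c ^ \<mu> i) \<le> (1 / (1 - c :: real)) ^ k"
proof -
  have "(\<Sum>\<mu>\<in>exps k M. \<Prod>i=1..k. c ^ \<mu> i) = (\<Prod>i=1..k. \<Sum>a\<le>M. c ^ a)"
    by (rule sum_exps_prod)
  also have "\<dots> \<le> (\<Prod>i=1..k. 1 / (1 - c))"
  proof (intro prod_mono conjI sum_nonneg)
    have "(\<Sum>a\<le>M. c ^ a) \<le> (\<Sum>a. c ^ a)"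
      using assms by (intro sum_le_suminf summable_geometric) auto
    also have "\<dots> = 1 / (1 - c)" using assms by (intro suminf_geometric) auto
    finally show "(\<Sum>a\<le>M. c ^ a) \<le> 1 / (1 - c)" .
  qed (use assms in auto)
  finally show ?thesis by simp
qed

definition zero_exps :: "nat \<Rightarrow> nat \<Rightarrow> nat" where
  "zero_exps k = (\<lambda>i\<in>{1..k}. 0)"

lemma zero_exps_in: "zero_exps k \<in> exps k M"
  by (auto simp: zero_exps_def exps_def)

lemma zero_exps_apply [simp]: "i \<in> {1..k} \<Longrightarrow> zero_exps k i = 0"
  by (simp add: zero_exps_def)

lemma exps_nonzero:
  assumes "\<mu> \<in> exps k M - {zero_exps k}"
  shows "\<exists>i\<in>{1..k}. \<mu> i \<noteq> 0"
proof (rule ccontr)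
  assume "\<not> ?thesis"
  then have "\<mu> = zero_exps k"
    using assms zero_exps_in[of k M] unfolding exps_def by (intro PiE_ext[of \<mu>]) auto
  with assms show False by simp
qed

lemma local_mob_zero:
  assumes "k \<ge> 1" "p \<ge> 1"
  shows "local_mob r k p M (zero_exps k) = 1"
proof -
  have "excess k (zero_exps k) = 0"
    using excess_le_sum[of k "zero_exps k"] by simp
  from local_mob_eq_if_excess_0[OF assms this zero_exps_in] show ?thesis by simp
qed

lemma local_mob_sum_bound:
  assumes r: "r > -1" and k: "k \<ge> 1" and p: "p \<ge> 2" and j: "j \<in> {1..k}"
    and \<beta>: "0 \<le> \<beta>" "\<beta> \<le> saving r"
  shows "(\<Sum>\<mu>\<in>exps k M - {zero_exps k}.
      \<bar>local_mob r k p M \<mu>\<bar> * (\<Prod>i=1..k. (1 / real p) ^ \<mu> i) * real p powr (\<beta> * real (\<mu> j)))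
    \<le> local_const r k * real p powr - (1 + saving r)"
    (is "?L \<le> _")
proof -
  note sv = saving_bounds[OF r]
  have c: "2 powr - saving r < 1" using sv by (subst powr_less_one) auto
  have "?L \<le> (\<Sum>\<mu>\<in>exps k M - {zero_exps k}. 2 ^ k * real p powr - (1 + saving r) *
       (2 powr (2 * saving r) * (\<Prod>i=1..k. (2 powr - saving r) ^ \<mu> i)))"
  proof (rule sum_mono)
    fix \<mu> assume \<mu>: "\<mu> \<in> exps k M - {zero_exps k}"
    then have "\<mu> \<in> exps k M" by simp
    from local_mob_bound[OF r k p this exps_nonzero[OF \<mu>] j \<beta>]
    show "\<bar>local_mob r k p M \<mu>\<bar> * (\<Prod>i=1..k. (1 / real p) ^ \<mu> i) * real p powr (\<beta> * real (\<mu> j))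
      \<le> 2 ^ k * real p powr - (1 + saving r) *
         (2 powr (2 * saving r) * (\<Prod>i=1..k. (2 powr - saving r) ^ \<mu> i))" .
  qed
  also have "\<dots> \<le> (\<Sum>\<mu>\<in>exps k M. 2 ^ k * real p powr - (1 + saving r) *
       (2 powr (2 * saving r) * (\<Prod>i=1..k. (2 powr - saving r) ^ \<mu> i)))"
    by (intro sum_mono2) (auto intro!: mult_nonneg_nonneg prod_nonneg)
  also have "\<dots> = 2 ^ k * real p powr - (1 + saving r) *
       (2 powr (2 * saving r) * (\<Sum>\<mu>\<in>exps k M. \<Prod>i=1..k. (2 powr - saving r) ^ \<mu> i))"
    unfolding sum_distrib_left ..
  also have "\<dots> \<le> 2 ^ k * real p powr - (1 + saving r) *
       (2 powr (2 * saving r) * (1 / (1 - 2 powr - saving r)) ^ k)"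
    by (intro mult_left_mono sum_exps_power_le c) auto
  also have "\<dots> = local_const r k * real p powr - (1 + saving r)"
    by (simp only: local_const_def mult_ac)
  finally show ?thesis .
qed

lemma local_mob_weighted_sum_le:
  assumes r: "r > -1" and k: "k \<ge> 1" and p: "p \<ge> 2" and j: "j \<in> {1..k}"
    and \<beta>: "0 \<le> \<beta>" "\<beta> \<le> saving r"
  shows "(\<Sum>\<mu>\<in>exps k M. \<bar>local_mob r k p M \<mu>\<bar> * (\<Prod>i=1..k. (1 / real p) ^ \<mu> i) * real p powr (\<beta> * real (\<mu> j)))
    \<le> 1 + local_const r k * real p powr - (1 + saving r)"
proof -
  have "local_mob r k p M (zero_exps k) = 1" using p by (intro local_mob_zero k) auto
  with local_mob_sum_bound[OF assms, of M] j p show ?thesis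
    by (subst sum.remove[OF finite_exps zero_exps_in]) simp
qed

text \<open>The Euler factor at \<open>p\<close> of the Dirichlet series of \<open>g\<close> with
  all variables equal to 1, exponents being cut off at \<open>M\<close>.\<close>

definition local_sum :: "real \<Rightarrow> nat \<Rightarrow> nat \<Rightarrow> nat \<Rightarrow> real" where
  "local_sum r k p M = (\<Sum>\<mu>\<in>exps k M. local_mob r k p M \<mu> * (\<Prod>i=1..k. (1 / real p) ^ \<mu> i))"

lemma local_sum_near_1:
  assumes r: "r > -1" and k: "k \<ge> 1" and p: "p \<ge> 2"
  shows "\<bar>local_sum r k p M - 1\<bar> \<le> local_const r k * real p powr - (1 + saving r)"
proof -
  have eq: "local_sum r k p M - 1 = (\<Sum>\<mu>\<in>exps k M - {zero_exps k}. local_mob r k p M \<mu> * (\<Prod>i=1..k. (1 / real p) ^ \<mu> i))"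
  proof -
    have "local_mob r k p M (zero_exps k) = 1" using p by (intro local_mob_zero k) auto
    then show ?thesis unfolding local_sum_def
      by (subst sum.remove[OF finite_exps zero_exps_in]) simp
  qed
  \<comment> \<open>With \<open>\<beta> = 0\<close> the last factor is 1, so the weighted bound
    applies; coordinate 1 exists because \<open>k \<ge> 1\<close>.\<close>
  have "\<bar>local_sum r k p M - 1\<bar> \<le> (\<Sum>\<mu>\<in>exps k M - {zero_exps k}.
      \<bar>local_mob r k p M \<mu>\<bar> * (\<Prod>i=1..k. (1 / real p) ^ \<mu> i) * real p powr (0 * real (\<mu> 1)))"
    unfolding eq using p by (intro order.trans[OF sum_abs] sum_mono) (auto simp: abs_mult abs_prod)
  also have "\<dots> \<le> local_const r k * real p powr - (1 + saving r)"
    by (rule local_mob_sum_bound) (use assms saving_bounds[OF r] in auto)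
  finally show ?thesis .
qed

section \<open>Convergence of the local series\<close>

lemma local_term_nonneg: "local_term r k p \<nu> \<ge> 0"
  by (simp add: local_term_def)

lemma exps_subset_PiE: "exps k M \<subseteq> {1..k} \<rightarrow>\<^sub>E UNIV"
  unfolding exps_def by (rule PiE_mono) auto

lemma exps_mono: "M \<le> N \<Longrightarrow> exps k M \<subseteq> exps k N"
  unfolding exps_def by (rule PiE_mono) auto

lemma finite_subset_exps:
  assumes "finite F" "F \<subseteq> {1..k} \<rightarrow>\<^sub>E UNIV"
  shows "\<exists>M. F \<subseteq> exps k M"
proof -
  define M where "M = (\<Sum>\<nu>\<in>F. \<Sum>i=1..k. \<nu> i)"
  have "\<nu> i \<le> M" if "\<nu> \<in> F" "i \<in> {1..k}" for \<nu> i
  proof -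
    have "\<nu> i \<le> (\<Sum>i=1..k. \<nu> i)" using that by (intro member_le_sum) auto
    also have "\<dots> \<le> M" unfolding M_def by (rule member_le_sum[OF that(1)]) (use assms in auto)
    finally show ?thesis .
  qed
  then have "F \<subseteq> exps k M" using assms by (fastforce simp: exps_def PiE_iff)
  then show ?thesis ..
qed

text \<open>The boxes are cofinal among the finite sets of exponent vectors, so an unordered sum is
  a limit of sums over boxes.\<close>

lemma filterlim_exps: "filterlim (exps k) (finite_subsets_at_top ({1..k} \<rightarrow>\<^sub>E UNIV)) sequentially"
  unfolding filterlim_iff
proof safe
  fix P assume "eventually P (finite_subsets_at_top ({1..k} \<rightarrow>\<^sub>E (UNIV :: nat set)))"
  then obtain F where F: "finite F" "F \<subseteq> {1..k} \<rightarrow>\<^sub>E UNIV"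
    "\<And>Y. finite Y \<Longrightarrow> F \<subseteq> Y \<Longrightarrow> Y \<subseteq> {1..k} \<rightarrow>\<^sub>E UNIV \<Longrightarrow> P Y"
    unfolding eventually_finite_subsets_at_top by metis
  from finite_subset_exps[OF F(1,2)] obtain M where "F \<subseteq> exps k M" ..
  then have "\<forall>N\<ge>M. P (exps k N)"
    using F(3) exps_mono[of M] exps_subset_PiE by (metis finite_exps subset_trans)
  then show "\<forall>\<^sub>F N in sequentially. P (exps k N)"
    unfolding eventually_sequentially by blast
qed

text \<open>Since the excess is at most the sum of the entries, a term is dominated by a product of
  \<open>k\<close> geometric terms of ratio \<open>p powr - (2 * saving r)\<close>.\<close>

lemma local_term_summable:
  assumes r: "r > -1" and k: "k \<ge> 1" and p: "p \<ge> 2"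
  shows "local_term r k p summable_on ({1..k} \<rightarrow>\<^sub>E UNIV)"
proof (rule nonneg_bdd_above_summable_on)
  define c where "c = real p powr - (2 * saving r)"
  note sv = saving_bounds[OF r]
  have c: "0 \<le> c" "c < 1" unfolding c_def using sv p by (auto intro!: powr_less_one)
  have le: "local_term r k p \<nu> \<le> (\<Prod>i=1..k. c ^ \<nu> i)" for \<nu>
  proof -
    have "local_weight r k p \<nu> \<le> real p powr ((1 - 2 * saving r) * real (excess k \<nu>))"
      using local_weight_le[OF r k, of p \<nu> \<nu>] p by simp
    also have "\<dots> \<le> real p powr ((1 - 2 * saving r) * real (\<Sum>i=1..k. \<nu> i))"
      using p sv excess_le_sum[of k \<nu>] by (intro powr_mono mult_left_mono) (auto simp del: of_nat_sum)
    finally have "local_term r k p \<nu> \<le>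
        real p powr ((1 - 2 * saving r) * real (\<Sum>i=1..k. \<nu> i)) * real p powr - real (\<Sum>i=1..k. \<nu> i)"
      using p k by (subst local_term_eq, simp, simp, subst prod_inverse_power)
        (auto intro: mult_right_mono simp del: of_nat_sum)
    also have "\<dots> = (\<Prod>i=1..k. c ^ \<nu> i)"
      unfolding power_sum [symmetric] powr_add [symmetric] c_def using p
      by (subst powr_realpow [symmetric]) (simp_all add: powr_powr algebra_simps del: of_nat_sum)
    finally show ?thesis .
  qed
  show "bdd_above (sum (local_term r k p) ` {F. F \<subseteq> {1..k} \<rightarrow>\<^sub>E UNIV \<and> finite F})"
  proof (rule bdd_aboveI2)
    fix F assume "F \<in> {F. F \<subseteq> {1..k} \<rightarrow>\<^sub>E (UNIV :: nat set) \<and> finite F}"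
    then obtain M where M: "F \<subseteq> exps k M" using finite_subset_exps[of F k] by auto
    have "sum (local_term r k p) F \<le> sum (local_term r k p) (exps k M)"
      by (intro sum_mono2 M local_term_nonneg finite_exps)
    also have "\<dots> \<le> (\<Sum>\<nu>\<in>exps k M. \<Prod>i=1..k. c ^ \<nu> i)" by (intro sum_mono le)
    also have "\<dots> \<le> (1 / (1 - c)) ^ k" by (intro sum_exps_power_le c)
    finally show "sum (local_term r k p) F \<le> (1 / (1 - c)) ^ k" .
  qed
qed (simp add: local_term_nonneg)

lemma local_term_partial_sums:
  assumes "r > -1" "k \<ge> 1" "p \<ge> 2"
  shows "(\<lambda>M. sum (local_term r k p) (exps k M)) \<longlonglongrightarrow> infsum (local_term r k p) ({1..k} \<rightarrow>\<^sub>E UNIV)"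
  using has_sum_infsum[OF local_term_summable[OF assms]] filterlim_exps
  unfolding has_sum_def by (rule filterlim_compose)

text \<open>On \<open>exps k M\<close> the cutoff at \<open>Suc M\<close> is invisible and summation
  by parts gives exactly \<open>(1 - z) ^ k * T M\<close>. The outer layer is bounded by an
  increment of the convergent sequence \<open>T\<close>, hence tends to 0.\<close>

lemma local_sum_tendsto:
  assumes r: "r > -1" and k: "k \<ge> 1" and p: "p \<ge> 2"
  shows "local_sum r k p \<longlonglongrightarrow> local_factor r k p"
proof -
  define z where "z = 1 / real p"
  have z: "0 \<le> z" "z \<le> 1" using p by (auto simp: z_def)
  define T where "T M = sum (local_term r k p) (exps k M)" for M
  define G where "G M \<nu> = local_weight r k p \<nu> * (\<Prod>i=1..k. z ^ \<nu> i * (1 - of_bool (\<nu> i < M) * z))"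
    for M and \<nu> :: "nat \<Rightarrow> nat"
  have lt: "local_term r k p \<nu> = local_weight r k p \<nu> * (\<Prod>i=1..k. z ^ \<nu> i)" for \<nu>
    using local_term_eq[of p k r \<nu>] p k by (simp add: z_def)
  have T: "T \<longlonglongrightarrow> infsum (local_term r k p) ({1..k} \<rightarrow>\<^sub>E UNIV)"
    unfolding T_def by (rule local_term_partial_sums[OF assms])
  have bound: "\<bar>local_sum r k p (Suc M) - (1 - z) ^ k * T M\<bar> \<le> T (Suc M) - T M" for M
  proof -
    have "local_sum r k p (Suc M) = sum (G (Suc M)) (exps k (Suc M))"
      unfolding local_sum_def local_mob_def sum_mixed_diff_power G_def z_def ..
    also have "\<dots> = sum (G (Suc M)) (exps k (Suc M) - exps k M) + sum (G (Suc M)) (exps k M)"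
      by (rule sum.subset_diff) (use exps_mono[of M "Suc M" k] in auto)
    also have "sum (G (Suc M)) (exps k M) = (1 - z) ^ k * T M"
      unfolding T_def sum_distrib_left
    proof (intro sum.cong refl)
      fix \<nu> assume \<nu>: "\<nu> \<in> exps k M"
      have "(\<Prod>i=1..k. z ^ \<nu> i * (1 - of_bool (\<nu> i < Suc M) * z)) = (\<Prod>i=1..k. z ^ \<nu> i * (1 - z))"
        by (intro prod.cong refl) (use exps_le[OF \<nu>] in \<open>auto simp: less_Suc_eq_le\<close>)
      then show "G (Suc M) \<nu> = (1 - z) ^ k * local_term r k p \<nu>"
        by (simp add: G_def lt prod.distrib)
    qed
    finally have eq: "local_sum r k p (Suc M) - (1 - z) ^ k * T M = sum (G (Suc M)) (exps k (Suc M) - exps k M)"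
      by simp
    have "\<bar>sum (G (Suc M)) (exps k (Suc M) - exps k M)\<bar> \<le> sum (local_term r k p) (exps k (Suc M) - exps k M)"
    proof (intro order.trans[OF sum_abs] sum_mono)
      fix \<nu>
      have "(\<Prod>i=1..k. z ^ \<nu> i * (1 - of_bool (\<nu> i < Suc M) * z)) \<le> (\<Prod>i=1..k. z ^ \<nu> i)"
        "0 \<le> (\<Prod>i=1..k. z ^ \<nu> i * (1 - of_bool (\<nu> i < Suc M) * z))"
        using z by (auto intro!: prod_mono prod_nonneg mult_left_le)
      then show "\<bar>G (Suc M) \<nu>\<bar> \<le> local_term r k p \<nu>"
        unfolding G_def lt abs_mult by (auto simp: local_weight_def intro!: mult_left_mono)
    qed
    also have "\<dots> = T (Suc M) - T M"
      unfolding T_def by (rule sum_diff) (use exps_mono[of M "Suc M" k] in auto)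
    finally show ?thesis unfolding eq .
  qed
  have diff: "(\<lambda>M. T (Suc M) - T M) \<longlonglongrightarrow> 0"
    using tendsto_diff[OF LIMSEQ_Suc[OF T] T] by simp
  have "(\<lambda>M. local_sum r k p (Suc M) - (1 - z) ^ k * T M) \<longlonglongrightarrow> 0"
    by (rule Lim_null_comparison[OF _ diff]) (simp add: bound)
  from tendsto_add[OF this tendsto_mult[OF tendsto_const T, of "(1 - z) ^ k"]]
  have "(\<lambda>M. local_sum r k p (Suc M)) \<longlonglongrightarrow> local_factor r k p"
    by (simp add: local_factor_def z_def)
  then show ?thesis by (rule LIMSEQ_imp_Suc)
qed

lemma local_factor_near_1:
  assumes "r > -1" "k \<ge> 1" "p \<ge> 2"
  shows "\<bar>local_factor r k p - 1\<bar> \<le> local_const r k * real p powr - (1 + saving r)"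
proof (rule tendsto_upperbound)
  show "(\<lambda>M. \<bar>local_sum r k p M - 1\<bar>) \<longlonglongrightarrow> \<bar>local_factor r k p - 1\<bar>"
    by (intro tendsto_rabs tendsto_diff tendsto_const local_sum_tendsto assms)
  show "\<forall>\<^sub>F M in sequentially. \<bar>local_sum r k p M - 1\<bar> \<le> local_const r k * real p powr - (1 + saving r)"
    by (intro always_eventually allI local_sum_near_1 assms)
qed auto

section \<open>Power sums\<close>

definition psum :: "real \<Rightarrow> real \<Rightarrow> real" where
  "psum t y = (\<Sum>n\<in>{n. 0 < n \<and> real n \<le> y}. real n powr t)"

lemma powr_between:
  fixes a b \<xi> t :: real
  assumes "0 < a" "a \<le> \<xi>" "\<xi> \<le> b"
  shows "min (a powr t) (b powr t) \<le> \<xi> powr t" "\<xi> powr t \<le> max (a powr t) (b powr t)"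
proof -
  have "a powr t \<le> \<xi> powr t \<and> \<xi> powr t \<le> b powr t \<or> b powr t \<le> \<xi> powr t \<and> \<xi> powr t \<le> a powr t"
  proof (cases "t \<ge> 0")
    case True
    then show ?thesis using assms by (intro disjI1 conjI powr_mono2) auto
  next
    case False
    then show ?thesis using assms by (intro disjI2 conjI powr_mono2') auto
  qed
  then show "min (a powr t) (b powr t) \<le> \<xi> powr t" "\<xi> powr t \<le> max (a powr t) (b powr t)"
    by auto
qed

text \<open>The mean value theorem; the left side plays the part of the integral of the power
  \<open>t\<close> from \<open>a\<close> to \<open>b\<close>.\<close>

lemma powr_increment:
  fixes a b t :: real
  assumes "0 < a" "a \<le> b" "t > -1"
  obtains \<xi> where "a \<le> \<xi>" "\<xi> \<le> b" "(b powr (t + 1) - a powr (t + 1)) / (t + 1) = (b - a) * \<xi> powr t"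
proof (cases "a = b")
  case True
  then show ?thesis using that[of a] by simp
next
  case False
  have "\<exists>z>a. z < b \<and> b powr (t + 1) - a powr (t + 1) = (b - a) * ((t + 1) * z powr t)"
    using assms False by (intro MVT2) (auto intro!: derivative_eq_intros)
  then obtain z where "z > a" "z < b" "b powr (t + 1) - a powr (t + 1) = (b - a) * ((t + 1) * z powr t)"
    by blast
  then show ?thesis using assms(3) by (intro that[of z]) auto
qed

text \<open>On each unit interval the error is at most the variation of the power there; by
  monotonicity these variations add up to the variation from 1 to \<open>real N + 1\<close>.\<close>

lemma sum_powr_integral_error:
  fixes t :: real
  assumes "t > -1"
  shows "\<bar>(\<Sum>n=1..N. real n powr t) - ((real N + 1) powr (t + 1) - 1) / (t + 1)\<bar> \<le> \<bar>(real N + 1) powr t - 1\<bar>"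
proof (induction N)
  case (Suc N)
  obtain \<xi> where \<xi>: "real N + 1 \<le> \<xi>" "\<xi> \<le> real N + 2"
    "((real N + 2) powr (t + 1) - (real N + 1) powr (t + 1)) / (t + 1) = \<xi> powr t"
    using powr_increment[of "real N + 1" "real N + 2" t] assms by auto
  have "(\<Sum>n=1..Suc N. real n powr t) - ((real (Suc N) + 1) powr (t + 1) - 1) / (t + 1)
     = ((\<Sum>n=1..N. real n powr t) - ((real N + 1) powr (t + 1) - 1) / (t + 1)) + ((real N + 1) powr t - \<xi> powr t)"
    unfolding \<xi>(3)[symmetric] by (simp add: algebra_simps diff_divide_distrib)
  moreover have "\<bar>(real N + 1) powr t - \<xi> powr t\<bar> \<le> \<bar>(real N + 2) powr t - (real N + 1) powr t\<bar>"
    using powr_between[of "real N + 1" \<xi> "real N + 2" t] \<xi> by (auto simp: min_def max_def split: if_splits)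
  moreover have "\<bar>(real N + 1) powr t - 1\<bar> + \<bar>(real N + 2) powr t - (real N + 1) powr t\<bar> = \<bar>(real N + 2) powr t - 1\<bar>"
  proof (cases "t \<ge> 0")
    case True
    then have "1 \<le> (real N + 1) powr t" "(real N + 1) powr t \<le> (real N + 2) powr t"
      by (auto intro: ge_one_powr_ge_zero powr_mono2)
    then show ?thesis by linarith
  next
    case False
    then have "(real N + 1) powr t \<le> 1 powr t" "(real N + 2) powr t \<le> (real N + 1) powr t"
      by (auto intro!: powr_mono2' simp del: powr_one_eq_one)
    then show ?thesis by simp
  qed
  ultimately show ?case using Suc by (simp add: add.commute)
qed auto

lemma psum_eq:
  assumes "y \<ge> 0"
  shows "psum t y = (\<Sum>n=1..nat \<lfloor>y\<rfloor>. real n powr t)"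
  unfolding psum_def using assms by (intro sum.cong) (auto simp: le_nat_floor le_floor_iff nat_le_iff le_nat_iff Suc_le_eq)

lemma psum_nonneg: "psum t y \<ge> 0"
  unfolding psum_def by (intro sum_nonneg) auto

lemma psum_lt_1: "y < 1 \<Longrightarrow> psum t y = 0"
  unfolding psum_def by (rule sum.neutral) auto

lemma powr_le_powr_max:
  fixes a y t :: real
  assumes "1 \<le> a" "a \<le> y"
  shows "a powr t \<le> y powr max t 0"
proof -
  have "a powr t \<le> a powr max t 0" using assms by (intro powr_mono) auto
  also have "\<dots> \<le> y powr max t 0" using assms by (intro powr_mono2) auto
  finally show ?thesis .
qed

lemma psum_asymp_ge_1:
  assumes t: "t > -1" and y: "y \<ge> 1"
  shows "\<bar>psum t y - y powr (t + 1) / (t + 1)\<bar> \<le> (3 + 1 / (t + 1)) * y powr max t 0"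
proof -
  \<comment> \<open>One less than the floor, so that \<open>real N + 1\<close> is the last integer
    up to \<open>y\<close>: its term is counted apart, and a piece of length below 1
    remains.\<close>
  define N where "N = nat \<lfloor>y\<rfloor> - 1"
  have N: "real N + 1 \<le> y" "y < real N + 2" "nat \<lfloor>y\<rfloor> = Suc N"
    using y unfolding N_def by linarith+
  define Y where "Y = y powr max t 0"
  have Y: "a powr t \<le> Y" if "1 \<le> a" "a \<le> y" for a
    unfolding Y_def using that by (rule powr_le_powr_max)
  have Y1: "1 \<le> Y" using Y[of 1] y by simp
  obtain \<xi> where \<xi>: "real N + 1 \<le> \<xi>" "\<xi> \<le> y"
    "(y powr (t + 1) - (real N + 1) powr (t + 1)) / (t + 1) = (y - (real N + 1)) * \<xi> powr t"
    using powr_increment[of "real N + 1" y t] t N by auto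
  have "\<bar>(y - (real N + 1)) * \<xi> powr t\<bar> \<le> 1 * Y"
    unfolding abs_mult using N \<xi> by (intro mult_mono) (auto intro!: Y)
  moreover have "\<bar>(real N + 1) powr t - 1\<bar> \<le> Y"
    using Y[of "real N + 1"] N Y1 by (auto simp: abs_le_iff intro: order.trans[of _ 1])
  moreover have "\<bar>(real N + 1) powr t\<bar> \<le> Y"
    using Y[of "real N + 1"] N by auto
  moreover have "\<bar>1 / (t + 1)\<bar> \<le> 1 / (t + 1) * Y" using t Y1 by (simp add: divide_right_mono)
  moreover have "psum t y - y powr (t + 1) / (t + 1) =
     ((\<Sum>n=1..N. real n powr t) - ((real N + 1) powr (t + 1) - 1) / (t + 1)) + (real N + 1) powr t
       - 1 / (t + 1) - (y - (real N + 1)) * \<xi> powr t"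
    unfolding \<xi>(3)[symmetric] using y by (subst psum_eq) (auto simp: N diff_divide_distrib add.commute)
  moreover note sum_powr_integral_error[OF t, of N]
  ultimately have "\<bar>psum t y - y powr (t + 1) / (t + 1)\<bar> \<le> 3 * Y + 1 / (t + 1) * Y"
    by linarith
  then show ?thesis by (simp add: Y_def distrib_right)
qed

text \<open>All positive \<open>y\<close> are covered because \<open>y = x / d\<close> occurs with
  \<open>d > x\<close>. For \<open>y < 1\<close> the sum is empty and the main term is small enough;
  for \<open>y \<ge> 1\<close> the condition on \<open>\<beta>\<close> gives
  \<open>max t 0 \<le> t + 1 - \<beta>\<close>.\<close>

lemma psum_bounds:
  assumes t: "t > -1" and \<beta>: "0 \<le> \<beta>" "\<beta> \<le> min (t + 1) 1"
  obtains K where "K \<ge> 1 / (t + 1)"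
    "\<And>y. y > 0 \<Longrightarrow> \<bar>psum t y - y powr (t + 1) / (t + 1)\<bar> \<le> K * y powr (t + 1 - \<beta>)"
    "\<And>y. y > 0 \<Longrightarrow> \<bar>psum t y\<bar> \<le> K * y powr (t + 1)"
proof -
  \<comment> \<open>The error constant \<open>3 + 1 / (t + 1)\<close> plus the coefficient
    \<open>1 / (t + 1)\<close> of the main term, as the last bound requires.\<close>
  define K where "K = 3 + 2 / (t + 1)"
  have K: "3 + 1 / (t + 1) \<le> K" "1 / (t + 1) \<le> K" "1 / (t + 1) + (3 + 1 / (t + 1)) = K" "K \<ge> 0"
    using t by (auto simp: K_def field_simps)
  show ?thesis
  proof (rule that[of K])
    fix y :: real assume y: "y > 0"
    have 1: "\<bar>psum t y - y powr (t + 1) / (t + 1)\<bar> \<le> (3 + 1 / (t + 1)) * y powr (t + 1 - \<beta>)"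
      if "y \<ge> 1"
    proof -
      have "y powr max t 0 \<le> y powr (t + 1 - \<beta>)" using that \<beta> by (intro powr_mono) auto
      then show ?thesis using t
        by (intro order.trans[OF psum_asymp_ge_1[OF t that]] mult_left_mono) auto
    qed
    show "\<bar>psum t y - y powr (t + 1) / (t + 1)\<bar> \<le> K * y powr (t + 1 - \<beta>)"
    proof (cases "y < 1")
      case True
      have "y powr (t + 1) \<le> y powr (t + 1 - \<beta>)" using True y \<beta> by (intro powr_mono') auto
      then have "1 / (t + 1) * y powr (t + 1) \<le> K * y powr (t + 1 - \<beta>)"
        using K t by (intro mult_mono) auto
      then show ?thesis using True t by (simp add: psum_lt_1)
    next
      case False
      then show ?thesis using 1 K by (auto elim!: order.trans intro!: mult_right_mono)
    qed
    show "\<bar>psum t y\<bar> \<le> K * y powr (t + 1)"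
    proof (cases "y < 1")
      case True
      then show ?thesis using K by (simp add: psum_lt_1)
    next
      case False
      have "y powr (t + 1 - \<beta>) \<le> y powr (t + 1)" using False \<beta> by (intro powr_mono) auto
      then have "(3 + 1 / (t + 1)) * y powr (t + 1 - \<beta>) \<le> (3 + 1 / (t + 1)) * y powr (t + 1)"
        using t by (intro mult_left_mono) auto
      then have "\<bar>psum t y\<bar> \<le> y powr (t + 1) / (t + 1) + (3 + 1 / (t + 1)) * y powr (t + 1)"
        using 1 False t psum_nonneg[of t y] by (auto simp: abs_le_iff)
      also have "\<dots> = K * y powr (t + 1)" unfolding K(3)[symmetric] by (simp add: algebra_simps)
      finally show ?thesis .
    qed
  qed (use K in auto)
qed

section \<open>The convolution identity and the error term\<close>

lemma multiplicity_Lcm_image: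
  fixes f :: "'a \<Rightarrow> nat"
  assumes "finite A" "A \<noteq> {}" "prime p" "\<And>i. i \<in> A \<Longrightarrow> f i > 0"
  shows "multiplicity p (LCM i\<in>A. f i) = (MAX i\<in>A. multiplicity p (f i))"
  using assms
proof (induction rule: finite_ne_induct)
  case (insert a A)
  have "0 \<notin> f ` A" using insert.prems(2) by fastforce
  then have "Lcm (f ` A) \<noteq> 0" using insert.hyps by (auto simp: Lcm_0_iff)
  then have "multiplicity p (lcm (f a) (Lcm (f ` A))) = max (multiplicity p (f a)) (multiplicity p (Lcm (f ` A)))"
    using insert by (intro multiplicity_lcm) auto
  with insert show ?case by simp
qed auto

lemma eq_prod_prime_powers:
  fixes n :: nat
  assumes "finite P" "\<And>p. p \<in> P \<Longrightarrow> prime p" "n > 0" "prime_factors n \<subseteq> P"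
  shows "n = (\<Prod>p\<in>P. p ^ multiplicity p n)"
proof (rule multiplicity_eq_nat)
  show "(\<Prod>p\<in>P. p ^ multiplicity p n) > 0"
    using assms(2) by (intro prod_pos) (auto simp: prime_gt_0_nat)
  fix q :: nat assume "prime q"
  then show "multiplicity q n = multiplicity q (\<Prod>p\<in>P. p ^ multiplicity p n)"
    using assms by (subst multiplicity_prod_prime_powers)
      (auto simp: prime_factors_multiplicity subset_iff)
qed fact

lemma prod_prime_powers_dvd_iff:
  fixes n :: nat
  assumes "finite P" "\<And>p. p \<in> P \<Longrightarrow> prime p" "n > 0"
  shows "(\<Prod>p\<in>P. p ^ e p) dvd n \<longleftrightarrow> (\<forall>p\<in>P. e p \<le> multiplicity p n)"
proof
  assume dvd: "(\<Prod>p\<in>P. p ^ e p) dvd n"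
  show "\<forall>p\<in>P. e p \<le> multiplicity p n"
  proof
    fix p assume p: "p \<in> P"
    have "multiplicity p (\<Prod>p\<in>P. p ^ e p) \<le> multiplicity p n"
      using dvd assms by (intro dvd_imp_multiplicity_le) auto
    with p assms show "e p \<le> multiplicity p n"
      by (subst (asm) multiplicity_prod_prime_powers) auto
  qed
next
  assume le: "\<forall>p\<in>P. e p \<le> multiplicity p n"
  show "(\<Prod>p\<in>P. p ^ e p) dvd n"
  proof (rule multiplicity_le_imp_dvd)
    show "(\<Prod>p\<in>P. p ^ e p) \<noteq> 0"
      using assms(1,2) not_prime_0 by (subst prod_zero_iff) (auto simp del: not_prime_0)
    fix q :: nat assume "prime q"
    then show "multiplicity q (\<Prod>p\<in>P. p ^ e p) \<le> multiplicity q n"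
      using le assms by (subst multiplicity_prod_prime_powers) auto
  qed
qed

section \<open>The truncated convolution identity\<close>

definition lcm_ratio :: "nat \<Rightarrow> (nat \<Rightarrow> nat) \<Rightarrow> real" where
  "lcm_ratio k n = real (lcm_tuple k n) / real (\<Prod>i=1..k. n i)"

lemma excess_cong: "(\<And>i. i \<in> {1..k} \<Longrightarrow> \<mu> i = \<nu> i) \<Longrightarrow> excess k \<mu> = excess k \<nu>"
  unfolding excess_def by (intro arg_cong2[where f = "(-)"] sum.cong arg_cong[where f = Max] image_cong) auto

text \<open>At each prime the least common multiple has the maximum of the exponents and the product
  has their sum, so the ratio has minus the excess.\<close>

lemma lcm_ratio_powr:
  assumes k: "k \<ge> 1" and P: "finite P" "\<And>p. p \<in> P \<Longrightarrow> prime p"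
    and n: "\<And>i. i \<in> {1..k} \<Longrightarrow> n i > 0 \<and> prime_factors (n i) \<subseteq> P"
  shows "lcm_ratio k n powr r = (\<Prod>p\<in>P. local_weight r k p (\<lambda>i\<in>{1..k}. multiplicity p (n i)))"
proof -
  define m where "m p i = multiplicity p (n i)" for p i
  have ni: "real (n i) = (\<Prod>p\<in>P. real p ^ m p i)" if "i \<in> {1..k}" for i
  proof -
    have "n i = (\<Prod>p\<in>P. p ^ m p i)"
      unfolding m_def using n[OF that] by (intro eq_prod_prime_powers P) auto
    from arg_cong[OF this, of real] show ?thesis by simp
  qed
  have "0 \<notin> n ` {1..k}" using n by fastforce
  then have "lcm_tuple k n > 0" unfolding lcm_tuple_def by (intro Nat.gr0I) (auto simp: Lcm_0_iff)
  moreover have "prime_factors (lcm_tuple k n) \<subseteq> P"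
  proof
    fix q assume q: "q \<in> prime_factors (lcm_tuple k n)"
    then have "(MAX i\<in>{1..k}. m q i) > 0"
      using multiplicity_Lcm_image[of "{1..k}" q n] n k
      unfolding lcm_tuple_def m_def by (auto simp: prime_factors_multiplicity)
    then obtain i where "i \<in> {1..k}" "m q i > 0"
      using k by (subst (asm) Max_gr_iff) auto
    then show "q \<in> P" using n[of i] q by (auto simp: m_def prime_factors_multiplicity)
  qed
  ultimately have "lcm_tuple k n = (\<Prod>p\<in>P. p ^ multiplicity p (lcm_tuple k n))"
    using P by (intro eq_prod_prime_powers)
  also have "\<dots> = (\<Prod>p\<in>P. p ^ (MAX i\<in>{1..k}. m p i))"
    unfolding lcm_tuple_def m_def using k P n
    by (intro prod.cong refl arg_cong2[where f = "(^)"] multiplicity_Lcm_image) auto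
  finally have L: "real (lcm_tuple k n) = (\<Prod>p\<in>P. real p ^ (MAX i\<in>{1..k}. m p i))" by simp
  have N: "real (\<Prod>i=1..k. n i) = (\<Prod>p\<in>P. real p ^ (\<Sum>i=1..k. m p i))"
    unfolding power_sum of_nat_prod by (subst prod.swap) (intro prod.cong refl ni)
  have "lcm_ratio k n = (\<Prod>p\<in>P. real p powr - real (excess k (m p)))"
    unfolding lcm_ratio_def L N prod_dividef [symmetric]
  proof (intro prod.cong refl)
    fix p assume "p \<in> P"
    then have "p > 0" using P prime_gt_0_nat by blast
    then have "real p ^ (MAX i\<in>{1..k}. m p i) / real p ^ (\<Sum>i=1..k. m p i)
      = real p powr (real (MAX i\<in>{1..k}. m p i) - real (\<Sum>i=1..k. m p i))"
      by (simp add: powr_diff powr_realpow del: of_nat_sum)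
    also have "\<dots> = real p powr - real (excess k (m p))"
      unfolding excess_plus_Max[OF k, symmetric] by simp
    finally show "real p ^ (MAX i\<in>{1..k}. m p i) / real p ^ (\<Sum>i=1..k. m p i) = \<dots>" .
  qed
  then have "lcm_ratio k n powr r = (\<Prod>p\<in>P. (real p powr - real (excess k (m p))) powr r)"
    by (simp add: prod_powr_distrib)
  also have "\<dots> = (\<Prod>p\<in>P. local_weight r k p (\<lambda>i\<in>{1..k}. multiplicity p (n i)))"
    unfolding local_weight_def powr_powr
    by (intro prod.cong refl arg_cong2[where f = "(powr)"])
       (auto simp: m_def mult.commute intro!: excess_cong)
  finally show ?thesis .
qed

text \<open>A family \<open>h\<close> of exponent vectors, one for each prime in \<open>P\<close>,
  encodes a tuple of divisors, of which this is entry \<open>i\<close>. Summing over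
  \<open>h\<close> lets sums over tuples arise from products over \<open>P\<close> by
  distributivity.\<close>

definition divisor_of :: "nat set \<Rightarrow> (nat \<Rightarrow> nat \<Rightarrow> nat) \<Rightarrow> nat \<Rightarrow> nat" where
  "divisor_of P h i = (\<Prod>p\<in>P. p ^ h p i)"

lemma finite_le_real: "finite {n. 0 < n \<and> real n \<le> x}"
  by (rule finite_subset[of _ "{..nat \<lfloor>x\<rfloor>}"]) (auto simp: le_nat_floor)

lemma psum_multiples:
  assumes "d > 0"
  shows "(\<Sum>n\<in>{n. 0 < n \<and> real n \<le> x}. of_bool (d dvd n) * real n powr t) = real d powr t * psum t (x / real d)"
proof -
  define X where "X = {n. 0 < n \<and> real n \<le> x}"
  have "finite X" unfolding X_def by (rule finite_le_real)
  then have "(\<Sum>n\<in>X. of_bool (d dvd n) * real n powr t) = (\<Sum>n\<in>{n\<in>X. d dvd n}. real n powr t)"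
    by (intro sum.mono_neutral_cong_right) auto
  also have "\<dots> = (\<Sum>n\<in>{n. 0 < n \<and> real n \<le> x / real d}. real (d * n) powr t)"
    by (rule sum.reindex_bij_witness[of _ "\<lambda>n. d * n" "\<lambda>n. n div d"])
       (use assms in \<open>auto simp: X_def field_simps real_of_nat_div elim!: dvdE\<close>)
  also have "\<dots> = real d powr t * psum t (x / real d)"
    unfolding psum_def sum_distrib_left by (intro sum.cong) (auto simp: powr_mult)
  finally show ?thesis unfolding X_def .
qed

text \<open>Invert at every prime, multiply out over \<open>P\<close>, and read the product of the
  conditions on exponents as divisibility in each coordinate; the sum over \<open>n\<close> then
  factors. The assumption on \<open>P\<close> and \<open>M\<close> makes the truncated identity
  exact.\<close>

lemma lcm_sum_identity:
  assumes k: "k \<ge> 1" and P: "finite P" "\<And>p. p \<in> P \<Longrightarrow> prime p"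
    and PM: "\<And>n. 0 < n \<Longrightarrow> real n \<le> x \<Longrightarrow> prime_factors n \<subseteq> P \<and> (\<forall>p. multiplicity p n \<le> M)"
  shows "(\<Sum>n\<in>tuples_upto k x. lcm_ratio k n powr r * (\<Prod>i=1..k. real (n i) powr t)) =
    (\<Sum>h\<in>P \<rightarrow>\<^sub>E exps k M. (\<Prod>p\<in>P. local_mob r k p M (h p)) *
      (\<Prod>i=1..k. real (divisor_of P h i) powr t * psum t (x / real (divisor_of P h i))))"
proof -
  define X where "X = {n. 0 < n \<and> real n \<le> x}"
  have X: "finite X" unfolding X_def by (rule finite_le_real)
  have tup: "tuples_upto k x = {1..k} \<rightarrow>\<^sub>E X" by (simp add: tuples_upto_def X_def)
  have expand: "lcm_ratio k n powr r * (\<Prod>i=1..k. real (n i) powr t) =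
     (\<Sum>h\<in>P \<rightarrow>\<^sub>E exps k M. (\<Prod>p\<in>P. local_mob r k p M (h p)) *
        (\<Prod>i=1..k. of_bool (divisor_of P h i dvd n i) * real (n i) powr t))"
    if n: "n \<in> {1..k} \<rightarrow>\<^sub>E X" for n
  proof -
    have n': "n i > 0 \<and> prime_factors (n i) \<subseteq> P" if "i \<in> {1..k}" for i
      using n that PM[of "n i"] by (force simp: X_def PiE_iff)
    have "lcm_ratio k n powr r = (\<Prod>p\<in>P. local_weight r k p (\<lambda>i\<in>{1..k}. multiplicity p (n i)))"
      by (rule lcm_ratio_powr[OF k P n']) auto
    also have "\<dots> = (\<Prod>p\<in>P. \<Sum>\<mu>\<in>exps k M. local_mob r k p M \<mu> * (\<Prod>i=1..k. of_bool (\<mu> i \<le> multiplicity p (n i))))"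
    proof (intro prod.cong refl)
      fix p
      have "(\<lambda>i\<in>{1..k}. multiplicity p (n i)) \<in> exps k M"
        using n PM by (auto simp: exps_def X_def PiE_iff)
      from mixed_diff_inversion[OF this, of "local_weight r k p"]
      show "local_weight r k p (\<lambda>i\<in>{1..k}. multiplicity p (n i)) =
        (\<Sum>\<mu>\<in>exps k M. local_mob r k p M \<mu> * (\<Prod>i=1..k. of_bool (\<mu> i \<le> multiplicity p (n i))))"
        by (simp add: local_mob_def)
    qed
    also have "\<dots> = (\<Sum>h\<in>P \<rightarrow>\<^sub>E exps k M. \<Prod>p\<in>P. local_mob r k p M (h p) * (\<Prod>i=1..k. of_bool (h p i \<le> multiplicity p (n i))))"
      by (rule prod_sum_PiE) (use P in auto)
    also have "\<dots> = (\<Sum>h\<in>P \<rightarrow>\<^sub>E exps k M. (\<Prod>p\<in>P. local_mob r k p M (h p)) * (\<Prod>i=1..k. of_bool (divisor_of P h i dvd n i)))"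
    proof (intro sum.cong refl)
      fix h
      have "(\<Prod>p\<in>P. \<Prod>i=1..k. of_bool (h p i \<le> multiplicity p (n i))) = (\<Prod>i=1..k. \<Prod>p\<in>P. of_bool (h p i \<le> multiplicity p (n i)) :: real)"
        by (rule prod.swap)
      also have "\<dots> = (\<Prod>i=1..k. of_bool (divisor_of P h i dvd n i))"
        unfolding divisor_of_def
        by (intro prod.cong refl) (use P n' in \<open>simp add: prod_of_bool prod_prime_powers_dvd_iff del: of_bool_eq_iff\<close>)
      finally show "(\<Prod>p\<in>P. local_mob r k p M (h p) * (\<Prod>i=1..k. of_bool (h p i \<le> multiplicity p (n i)))) =
         (\<Prod>p\<in>P. local_mob r k p M (h p)) * (\<Prod>i=1..k. of_bool (divisor_of P h i dvd n i))"
        by (simp add: prod.distrib)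
    qed
    finally show ?thesis unfolding prod.distrib
      by (simp add: sum_distrib_right mult.assoc)
  qed
  have "(\<Sum>n\<in>tuples_upto k x. lcm_ratio k n powr r * (\<Prod>i=1..k. real (n i) powr t)) =
    (\<Sum>n\<in>{1..k} \<rightarrow>\<^sub>E X. \<Sum>h\<in>P \<rightarrow>\<^sub>E exps k M. (\<Prod>p\<in>P. local_mob r k p M (h p)) *
        (\<Prod>i=1..k. of_bool (divisor_of P h i dvd n i) * real (n i) powr t))"
    unfolding tup by (intro sum.cong refl expand)
  also have "\<dots> = (\<Sum>h\<in>P \<rightarrow>\<^sub>E exps k M. (\<Prod>p\<in>P. local_mob r k p M (h p)) *
      (\<Sum>n\<in>{1..k} \<rightarrow>\<^sub>E X. \<Prod>i=1..k. of_bool (divisor_of P h i dvd n i) * real (n i) powr t))"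
    unfolding sum_distrib_left by (rule sum.swap)
  also have "\<dots> = (\<Sum>h\<in>P \<rightarrow>\<^sub>E exps k M. (\<Prod>p\<in>P. local_mob r k p M (h p)) *
      (\<Prod>i=1..k. \<Sum>n\<in>X. of_bool (divisor_of P h i dvd n) * real n powr t))"
    using X by (subst prod_sum_PiE) auto
  also have "\<dots> = (\<Sum>h\<in>P \<rightarrow>\<^sub>E exps k M. (\<Prod>p\<in>P. local_mob r k p M (h p)) *
      (\<Prod>i=1..k. real (divisor_of P h i) powr t * psum t (x / real (divisor_of P h i))))"
    unfolding X_def
  proof (intro sum.cong refl arg_cong2[where f = "(*)"] prod.cong psum_multiples)
    fix h i show "divisor_of P h i > 0"
      unfolding divisor_of_def using P by (intro prod_pos) (auto simp: prime_gt_0_nat)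
  qed
  finally show ?thesis .
qed

text \<open>The factors \<open>a\<close> are exchanged for \<open>b\<close> one at a time, while
  \<open>B\<close> controls the remaining ones.\<close>

lemma abs_prod_diff_le:
  fixes a b B :: "'a \<Rightarrow> real"
  assumes "finite A" "\<And>i. i \<in> A \<Longrightarrow> \<bar>a i\<bar> \<le> B i" "\<And>i. i \<in> A \<Longrightarrow> \<bar>b i\<bar> \<le> B i"
  shows "\<bar>(\<Prod>i\<in>A. a i) - (\<Prod>i\<in>A. b i)\<bar> \<le> (\<Sum>j\<in>A. \<bar>a j - b j\<bar> * (\<Prod>i\<in>A - {j}. B i))"
  using assms
proof (induction rule: finite_induct)
  case (insert c A)
  have B: "B i \<ge> 0" if "i \<in> insert c A" for i
    using insert.prems(1)[OF that] by linarith
  have "(\<Prod>i\<in>insert c A. a i) - (\<Prod>i\<in>insert c A. b i)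
     = (a c - b c) * (\<Prod>i\<in>A. a i) + b c * ((\<Prod>i\<in>A. a i) - (\<Prod>i\<in>A. b i))"
    using insert.hyps by (simp add: algebra_simps)
  also have "\<bar>\<dots>\<bar> \<le> \<bar>a c - b c\<bar> * (\<Prod>i\<in>A. B i) + B c * (\<Sum>j\<in>A. \<bar>a j - b j\<bar> * (\<Prod>i\<in>A - {j}. B i))"
    using insert B
    by (intro order.trans[OF abs_triangle_ineq] add_mono)
       (auto simp: abs_mult abs_prod intro!: mult_mono prod_mono prod_nonneg)
  also have "B c * (\<Sum>j\<in>A. \<bar>a j - b j\<bar> * (\<Prod>i\<in>A - {j}. B i)) =
     (\<Sum>j\<in>A. \<bar>a j - b j\<bar> * (\<Prod>i\<in>insert c A - {j}. B i))"
    unfolding sum_distrib_left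
  proof (intro sum.cong refl)
    fix j assume "j \<in> A"
    then have "insert c A - {j} = insert c (A - {j})" using insert.hyps by auto
    then show "B c * (\<bar>a j - b j\<bar> * (\<Prod>i\<in>A - {j}. B i)) = \<bar>a j - b j\<bar> * (\<Prod>i\<in>insert c A - {j}. B i)"
      using insert.hyps by simp
  qed
  finally show ?case using insert.hyps by simp
qed auto

section \<open>Weighted sums of the convolution factor and the error term\<close>

lemma prod_divisor_of_inverse:
  assumes "finite P"
  shows "(\<Prod>i=1..k. 1 / real (divisor_of P h i)) = (\<Prod>p\<in>P. \<Prod>i=1..k. (1 / real p) ^ h p i)"
  unfolding divisor_of_def
  by (subst prod.swap) (simp add: prod_dividef power_one_over)

text \<open>A bound for the product of \<open>1 + local_const r k * p powr - (1 + saving r)\<close>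
  over any finite set of primes, obtained by letting the sum in the exponent run over all
  \<open>n\<close>.\<close>

definition global_const :: "real \<Rightarrow> nat \<Rightarrow> real" where
  "global_const r k = exp (local_const r k * (\<Sum>n. real n powr - (1 + saving r)))"

lemma local_const_nonneg: "r > -1 \<Longrightarrow> local_const r k \<ge> 0"
  using saving_bounds[of r] unfolding local_const_def
  by (intro mult_nonneg_nonneg zero_le_power) (auto intro!: less_imp_le powr_less_one)

lemma summable_saving: "r > -1 \<Longrightarrow> summable (\<lambda>n. real n powr - (1 + saving r))"
  using saving_bounds[of r] by (subst summable_real_powr_iff) auto

text \<open>The sum factors into an Euler product, and \<open>1 + y \<le> exp y\<close> reduces it
  to a convergent series. The bound involves neither \<open>P\<close> nor \<open>M\<close>, which
  the later limits rely on.\<close>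

lemma weighted_mob_sum_le:
  assumes r: "r > -1" and k: "k \<ge> 1" and P: "finite P" "\<And>p. p \<in> P \<Longrightarrow> prime p"
    and j: "j \<in> {1..k}" and \<beta>: "0 \<le> \<beta>" "\<beta> \<le> saving r"
  shows "(\<Sum>h\<in>P \<rightarrow>\<^sub>E exps k M. \<bar>\<Prod>p\<in>P. local_mob r k p M (h p)\<bar> *
      ((\<Prod>i=1..k. 1 / real (divisor_of P h i)) * real (divisor_of P h j) powr \<beta>)) \<le> global_const r k"
proof -
  have "(\<Sum>h\<in>P \<rightarrow>\<^sub>E exps k M. \<bar>\<Prod>p\<in>P. local_mob r k p M (h p)\<bar> *
      ((\<Prod>i=1..k. 1 / real (divisor_of P h i)) * real (divisor_of P h j) powr \<beta>)) =
     (\<Sum>h\<in>P \<rightarrow>\<^sub>E exps k M. \<Prod>p\<in>P. \<bar>local_mob r k p M (h p)\<bar> *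
        (\<Prod>i=1..k. (1 / real p) ^ h p i) * real p powr (\<beta> * real (h p j)))"
  proof (intro sum.cong refl)
    fix h
    have "real (divisor_of P h j) powr \<beta> = (\<Prod>p\<in>P. (real p ^ h p j) powr \<beta>)"
      by (simp add: divisor_of_def prod_powr_distrib)
    also have "\<dots> = (\<Prod>p\<in>P. real p powr (\<beta> * real (h p j)))"
    proof (intro prod.cong refl)
      fix p assume "p \<in> P"
      then have "real p > 0" using P prime_gt_0_nat by auto
      then show "(real p ^ h p j) powr \<beta> = real p powr (\<beta> * real (h p j))"
        by (simp add: powr_realpow [symmetric] powr_powr mult.commute)
    qed
    finally show "\<bar>\<Prod>p\<in>P. local_mob r k p M (h p)\<bar> *
      ((\<Prod>i=1..k. 1 / real (divisor_of P h i)) * real (divisor_of P h j) powr \<beta>) =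
      (\<Prod>p\<in>P. \<bar>local_mob r k p M (h p)\<bar> *
        (\<Prod>i=1..k. (1 / real p) ^ h p i) * real p powr (\<beta> * real (h p j)))"
      unfolding prod_divisor_of_inverse[OF P(1)] by (simp add: prod.distrib abs_prod)
  qed
  also have "\<dots> = (\<Prod>p\<in>P. \<Sum>\<mu>\<in>exps k M. \<bar>local_mob r k p M \<mu>\<bar> *
        (\<Prod>i=1..k. (1 / real p) ^ \<mu> i) * real p powr (\<beta> * real (\<mu> j)))"
    by (rule prod_sum_PiE [symmetric]) (use P in auto)
  also have "\<dots> \<le> (\<Prod>p\<in>P. exp (local_const r k * real p powr - (1 + saving r)))"
  proof (intro prod_mono conjI)
    fix p assume "p \<in> P"
    then have p: "p \<ge> 2" using P prime_ge_2_nat by auto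
    show "(\<Sum>\<mu>\<in>exps k M. \<bar>local_mob r k p M \<mu>\<bar> * (\<Prod>i=1..k. (1 / real p) ^ \<mu> i) * real p powr (\<beta> * real (\<mu> j)))
       \<le> exp (local_const r k * real p powr - (1 + saving r))"
      using local_mob_weighted_sum_le[OF r k p j \<beta>, of M] exp_ge_add_one_self order.trans by blast
  qed (auto intro!: sum_nonneg mult_nonneg_nonneg prod_nonneg)
  also have "\<dots> = exp (local_const r k * (\<Sum>p\<in>P. real p powr - (1 + saving r)))"
    using P by (simp add: exp_sum sum_distrib_left)
  also have "\<dots> \<le> global_const r k"
    unfolding global_const_def exp_le_cancel_iff
    by (intro mult_left_mono local_const_nonneg sum_le_suminf summable_saving r P) auto
  finally show ?thesis .
qed

text \<open>Each \<open>psum\<close> is compared with its main term. One factor at a time carries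
  the error, saving \<open>x powr - \<beta>\<close> at the price of \<open>d powr \<beta>\<close>,
  which the weighted sum of \<open>g\<close> absorbs. \<open>K\<close> is fixed before
  \<open>x\<close>, \<open>P\<close> and \<open>M\<close>.\<close>

lemma lcm_sum_near_finite_product:
  assumes r: "r > -1" and t: "t > -1" "saving r \<le> min (t + 1) 1" and k: "k \<ge> 1"
  obtains K where "\<And>x P M. x > 0 \<Longrightarrow> finite P \<Longrightarrow> (\<And>p. p \<in> P \<Longrightarrow> prime p) \<Longrightarrow>
    (\<And>n. 0 < n \<Longrightarrow> real n \<le> x \<Longrightarrow> prime_factors n \<subseteq> P \<and> (\<forall>p. multiplicity p n \<le> M)) \<Longrightarrow>
    \<bar>(\<Sum>n\<in>tuples_upto k x. lcm_ratio k n powr r * (\<Prod>i=1..k. real (n i) powr t)) -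
      (x powr (t + 1) / (t + 1)) ^ k * (\<Prod>p\<in>P. local_sum r k p M)\<bar>
    \<le> K * x powr (real k * (t + 1) - saving r)"
proof -
  define \<beta> where "\<beta> = saving r"
  have \<beta>: "0 \<le> \<beta>" "\<beta> \<le> saving r" "\<beta> \<le> min (t + 1) 1"
    using saving_bounds[OF r] t by (auto simp: \<beta>_def)
  obtain K where K: "K \<ge> 1 / (t + 1)"
    "\<And>y. y > 0 \<Longrightarrow> \<bar>psum t y - y powr (t + 1) / (t + 1)\<bar> \<le> K * y powr (t + 1 - \<beta>)"
    "\<And>y. y > 0 \<Longrightarrow> \<bar>psum t y\<bar> \<le> K * y powr (t + 1)"
    using psum_bounds[OF t(1) \<beta>(1,3)] by metis
  have K0: "K \<ge> 0" using K(1) t by (intro order.trans[OF _ K(1)]) auto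
  show ?thesis
  proof (rule that)
    fix x :: real and P :: "nat set" and M :: nat
    assume x: "x > 0" and P: "finite P" "\<And>p. p \<in> P \<Longrightarrow> prime p"
      and PM: "\<And>n. 0 < n \<Longrightarrow> real n \<le> x \<Longrightarrow> prime_factors n \<subseteq> P \<and> (\<forall>p. multiplicity p n \<le> M)"
    define X where "X = x powr (t + 1)"
    define m where "m h = (\<Prod>p\<in>P. local_mob r k p M (h p))" for h
    define d where "d h i = real (divisor_of P h i)" for h i
    have d: "d h i > 0" for h i
      unfolding d_def divisor_of_def using P by (auto intro!: prod_pos simp: prime_gt_0_nat)
    define E where "E = x powr (real k * (t + 1) - \<beta>)"
    have X0: "X > 0" using x by (simp add: X_def)
    have E: "E = X ^ k * x powr - \<beta>"
      unfolding E_def X_def using x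
      by (subst powr_realpow [symmetric]) (simp_all add: powr_powr powr_add [symmetric] mult.commute)
    \<comment> \<open>Multiplying out the local sums indexes the main term by the same families
      \<open>h\<close> as the convolution identity, so both can be compared term by term.\<close>
    have main: "(X / (t + 1)) ^ k * (\<Prod>p\<in>P. local_sum r k p M) =
      (\<Sum>h\<in>P \<rightarrow>\<^sub>E exps k M. m h * (\<Prod>i=1..k. X / (t + 1) / d h i))"
    proof -
      have "(\<Prod>p\<in>P. local_sum r k p M) =
        (\<Sum>h\<in>P \<rightarrow>\<^sub>E exps k M. \<Prod>p\<in>P. local_mob r k p M (h p) * (\<Prod>i=1..k. (1 / real p) ^ h p i))"
        unfolding local_sum_def by (rule prod_sum_PiE) (use P in auto)
      also have "\<dots> = (\<Sum>h\<in>P \<rightarrow>\<^sub>E exps k M. m h * (\<Prod>i=1..k. 1 / d h i))"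
        unfolding m_def d_def prod_divisor_of_inverse[OF P(1)] by (simp add: prod.distrib)
      moreover have "(\<Prod>i=1..k. X / (t + 1) / d h i) = (X / (t + 1)) ^ k * (\<Prod>i=1..k. 1 / d h i)" for h
        by (simp add: prod_dividef del: divide_divide_eq_left)
      ultimately show ?thesis by (simp only: sum_distrib_left mult_ac)
    qed
    have factor: "\<bar>(\<Prod>i=1..k. d h i powr t * psum t (x / d h i)) - (\<Prod>i=1..k. X / (t + 1) / d h i)\<bar>
       \<le> (\<Sum>j=1..k. K ^ k * E * ((\<Prod>i=1..k. 1 / d h i) * d h j powr \<beta>))" for h
    proof -
      \<comment> \<open>Used with \<open>c = 0\<close> for the size of a factor and with
        \<open>c = \<beta>\<close> for its error.\<close>
      have scale: "d h i powr t * (x / d h i) powr (t + 1 - c) = x powr (t + 1 - c) * d h i powr c / d h i" for i c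
      proof -
        have "d h i powr t / d h i powr (t + 1 - c) = d h i powr c / d h i"
          unfolding powr_diff [symmetric] using d[of h i]
          by (simp add: powr_diff powr_add divide_simps)
        from arg_cong[OF this, of "\<lambda>z. x powr (t + 1 - c) * z"] show ?thesis
          using x d[of h i] by (simp add: powr_divide mult.commute)
      qed
      have bound_a: "\<bar>d h i powr t * psum t (x / d h i)\<bar> \<le> K * X / d h i" for i
      proof -
        have "\<bar>d h i powr t * psum t (x / d h i)\<bar> \<le> d h i powr t * (K * (x / d h i) powr (t + 1))"
          unfolding abs_mult using x d[of h i] K(3)[of "x / d h i"] by (intro mult_mono) auto
        also have "\<dots> = K * X / d h i"
          using arg_cong[OF scale[of i 0], of "(*) K"] d[of h i] by (simp add: X_def mult_ac)
        finally show ?thesis .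
      qed
      have bound_b: "\<bar>X / (t + 1) / d h i\<bar> \<le> K * X / d h i" for i
      proof -
        have "1 / (t + 1) * X \<le> K * X" using K(1) X0 by (intro mult_right_mono) auto
        then have "X / (t + 1) / d h i \<le> K * X / d h i"
          using d[of h i] by (intro divide_right_mono) auto
        moreover have "0 \<le> X / (t + 1) / d h i" using t d[of h i] X0 by simp
        ultimately show ?thesis by linarith
      qed
      have err: "\<bar>d h j powr t * psum t (x / d h j) - X / (t + 1) / d h j\<bar>
          \<le> K * (x powr (t + 1 - \<beta>) * d h j powr \<beta> / d h j)" for j
      proof -
        have "X / d h j = d h j powr t * (x / d h j) powr (t + 1)"
          using scale[of j 0] d[of h j] by (simp add: X_def)
        moreover have "X / (t + 1) / d h j = X / d h j / (t + 1)" by simp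
        ultimately have "d h j powr t * psum t (x / d h j) - X / (t + 1) / d h j =
            d h j powr t * (psum t (x / d h j) - (x / d h j) powr (t + 1) / (t + 1))"
          by (simp only: right_diff_distrib times_divide_eq_right)
        also have "\<bar>\<dots>\<bar> \<le> d h j powr t * (K * (x / d h j) powr (t + 1 - \<beta>))"
          unfolding abs_mult using x d[of h j] K(2)[of "x / d h j"] by (intro mult_mono) auto
        also have "\<dots> = K * (x powr (t + 1 - \<beta>) * d h j powr \<beta> / d h j)"
          unfolding scale [symmetric] by simp
        finally show ?thesis .
      qed
      have "\<bar>(\<Prod>i=1..k. d h i powr t * psum t (x / d h i)) - (\<Prod>i=1..k. X / (t + 1) / d h i)\<bar>
         \<le> (\<Sum>j=1..k. \<bar>d h j powr t * psum t (x / d h j) - X / (t + 1) / d h j\<bar> *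
              (\<Prod>i\<in>{1..k} - {j}. K * X / d h i))"
        by (rule abs_prod_diff_le) (use bound_a bound_b in auto)
      also have "\<dots> \<le> (\<Sum>j=1..k. K ^ k * E * ((\<Prod>i=1..k. 1 / d h i) * d h j powr \<beta>))"
      proof (intro sum_mono)
        fix j assume j: "j \<in> {1..k}"
        have "\<bar>d h j powr t * psum t (x / d h j) - X / (t + 1) / d h j\<bar> * (\<Prod>i\<in>{1..k} - {j}. K * X / d h i)
           \<le> K * (x powr (t + 1 - \<beta>) * d h j powr \<beta> / d h j) * (\<Prod>i\<in>{1..k} - {j}. K * X / d h i)"
          using K0 X0 d by (intro mult_right_mono err prod_nonneg) (auto simp: less_imp_le)
        \<comment> \<open>Splitting off the saving gives index \<open>j\<close> the same factor
          \<open>K * X / d h j\<close> as the others, which completes the product.\<close>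
        also have "\<dots> = x powr - \<beta> * d h j powr \<beta> * (K * X / d h j * (\<Prod>i\<in>{1..k} - {j}. K * X / d h i))"
          unfolding X_def using x by (simp add: powr_diff powr_minus field_simps)
        also have "K * X / d h j * (\<Prod>i\<in>{1..k} - {j}. K * X / d h i) = (\<Prod>i=1..k. K * X / d h i)"
          using j by (subst (2) prod.remove[of _ j]) auto
        also have "\<dots> = K ^ k * X ^ k * (\<Prod>i=1..k. 1 / d h i)"
          by (simp add: prod_dividef power_mult_distrib)
        finally show "\<bar>d h j powr t * psum t (x / d h j) - X / (t + 1) / d h j\<bar> * (\<Prod>i\<in>{1..k} - {j}. K * X / d h i)
          \<le> K ^ k * E * ((\<Prod>i=1..k. 1 / d h i) * d h j powr \<beta>)"
          unfolding E by (simp add: mult_ac)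
      qed
      finally show ?thesis .
    qed
    have ident: "(\<Sum>n\<in>tuples_upto k x. lcm_ratio k n powr r * (\<Prod>i=1..k. real (n i) powr t)) =
      (\<Sum>h\<in>P \<rightarrow>\<^sub>E exps k M. m h * (\<Prod>i=1..k. d h i powr t * psum t (x / d h i)))"
      unfolding m_def d_def by (rule lcm_sum_identity[OF k P PM])
    have "\<bar>(\<Sum>n\<in>tuples_upto k x. lcm_ratio k n powr r * (\<Prod>i=1..k. real (n i) powr t)) -
      (X / (t + 1)) ^ k * (\<Prod>p\<in>P. local_sum r k p M)\<bar> =
      \<bar>\<Sum>h\<in>P \<rightarrow>\<^sub>E exps k M. m h *
        ((\<Prod>i=1..k. d h i powr t * psum t (x / d h i)) - (\<Prod>i=1..k. X / (t + 1) / d h i))\<bar>"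
      unfolding main ident by (simp add: sum_subtractf right_diff_distrib)
    also have "\<dots> \<le> (\<Sum>h\<in>P \<rightarrow>\<^sub>E exps k M. \<bar>m h\<bar> *
        (\<Sum>j=1..k. K ^ k * E * ((\<Prod>i=1..k. 1 / d h i) * d h j powr \<beta>)))"
      by (intro order.trans[OF sum_abs] sum_mono, unfold abs_mult) (intro mult_left_mono factor abs_ge_zero)
    also have "\<dots> = (\<Sum>j=1..k. K ^ k * E * (\<Sum>h\<in>P \<rightarrow>\<^sub>E exps k M. \<bar>m h\<bar> * ((\<Prod>i=1..k. 1 / d h i) * d h j powr \<beta>)))"
      unfolding sum_distrib_left by (subst sum.swap) (simp add: mult_ac)
    also have "\<dots> \<le> (\<Sum>j=1..k. K ^ k * E * global_const r k)"
      unfolding m_def d_def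
      by (intro sum_mono mult_left_mono weighted_mob_sum_le r k P \<beta>)
         (use K0 in \<open>auto simp: E_def\<close>)
    also have "\<dots> = (real k * K ^ k * global_const r k) * x powr (real k * (t + 1) - saving r)"
      by (simp add: E_def \<beta>_def)
    finally show "\<bar>(\<Sum>n\<in>tuples_upto k x. lcm_ratio k n powr r * (\<Prod>i=1..k. real (n i) powr t)) -
      (x powr (t + 1) / (t + 1)) ^ k * (\<Prod>p\<in>P. local_sum r k p M)\<bar>
      \<le> (real k * K ^ k * global_const r k) * x powr (real k * (t + 1) - saving r)"
      unfolding X_def .
  qed
qed

section \<open>The Euler product of the zeta function\<close>

lemma summable_inverse_powr: "s > 1 \<Longrightarrow> summable (\<lambda>n. 1 / real n powr s)"
  using summable_real_powr_iff[of "- s"] by (simp add: powr_minus divide_inverse)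

lemma zeta_has_sum:
  assumes "s > 1"
  shows "((\<lambda>n. 1 / real n powr s) has_sum zeta s) {1..}"
proof -
  have "(\<lambda>n. 1 / real (Suc n) powr s) sums zeta s"
    unfolding zeta_def using summable_inverse_powr[OF assms] summable_Suc_iff[of "\<lambda>n. 1 / real n powr s"]
    by (intro summable_sums) simp
  then have "((\<lambda>n. 1 / real (Suc n) powr s) has_sum zeta s) UNIV"
    by (rule sums_nonneg_imp_has_sum) auto
  then have "((\<lambda>n. 1 / real n powr s) has_sum zeta s) (range Suc)"
    by (subst has_sum_reindex) (auto simp: o_def)
  also have "range Suc = {1..}" by (auto simp: image_iff Suc_le_eq gr0_conv_Suc)
  finally show ?thesis .
qed

text \<open>A sieve: among the numbers free of primes in \<open>P\<close>, the multiples of a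
  further prime \<open>p\<close> are \<open>p\<close> times that same set, so they carry the
  fraction \<open>1 / real p powr s\<close> of its sum.\<close>

lemma coprime_zeta_sum:
  assumes "finite P" "\<And>p. p \<in> P \<Longrightarrow> prime p" "s > 1"
  shows "((\<lambda>n. 1 / real n powr s) has_sum (zeta s * (\<Prod>p\<in>P. 1 - 1 / real p powr s)))
    {n. n > 0 \<and> (\<forall>p\<in>P. \<not> p dvd n)}"
  using assms
proof (induction rule: finite_induct)
  case empty
  then show ?case using zeta_has_sum by (simp add: atLeast_def Suc_le_eq)
next
  case (insert p P)
  define A where "A = {n. n > 0 \<and> (\<forall>p\<in>P. \<not> p dvd n)}"
  define Z where "Z = zeta s * (\<Prod>p\<in>P. 1 - 1 / real p powr s)"
  have p: "prime p" using insert.prems by simp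
  have A: "((\<lambda>n. 1 / real n powr s) has_sum Z) A"
    unfolding A_def Z_def using insert by simp
  have *: "q dvd p * n \<longleftrightarrow> q dvd n" if "q \<in> P" for q n
    using that insert p by (metis insertCI prime_dvd_mult_iff primes_dvd_imp_eq)
  have sub: "(*) p ` A \<subseteq> A" using p by (auto simp: A_def * prime_gt_0_nat)
  have "((\<lambda>n. 1 / real p powr s * (1 / real n powr s)) has_sum (1 / real p powr s * Z)) A"
    by (rule has_sum_cmult_right[OF A])
  then have "((\<lambda>n. 1 / real n powr s) has_sum (1 / real p powr s * Z)) ((*) p ` A)"
    using p by (subst has_sum_reindex) (auto simp: inj_on_def o_def powr_mult prime_gt_0_nat)
  from has_sum_Diff[OF A this sub]
  have "((\<lambda>n. 1 / real n powr s) has_sum (Z - 1 / real p powr s * Z)) (A - (*) p ` A)" .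
  also have "A - (*) p ` A = {n. n > 0 \<and> (\<forall>p\<in>insert p P. \<not> p dvd n)}"
    using * by (auto simp: A_def elim!: dvdE)
  also have "Z - 1 / real p powr s * Z = zeta s * (\<Prod>p\<in>insert p P. 1 - 1 / real p powr s)"
    using insert by (simp add: Z_def algebra_simps)
  finally show ?case .
qed

text \<open>Sieving out the multiples of the primes up to \<open>N\<close> leaves \<open>1\<close> and a part of the tail.\<close>
lemma zeta_Euler_product:
  assumes s: "s > 1"
  shows "(\<lambda>N. zeta s * (\<Prod>p\<in>{p. p \<le> N \<and> prime p}. 1 - 1 / real p powr s)) \<longlonglongrightarrow> 1"
proof -
  define f where "f = (\<lambda>n::nat. 1 / real n powr s)"
  define Z where "Z N = zeta s * (\<Prod>p\<in>{p. p \<le> N \<and> prime p}. 1 - 1 / real p powr s)" for N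
  have f: "(f has_sum zeta s) {1..}" unfolding f_def by (rule zeta_has_sum[OF s])
  have bounds: "1 \<le> Z N \<and> Z N \<le> 1 + (zeta s - (\<Sum>n<N. f (Suc n)))" if N: "N \<ge> 1" for N
  proof -
    define S where "S = {n. n > 0 \<and> (\<forall>p\<in>{p. p \<le> N \<and> prime p}. \<not> p dvd n)}"
    have S: "(f has_sum Z N) S"
      unfolding S_def Z_def f_def by (rule coprime_zeta_sum) (use s in auto)
    have sub: "S \<subseteq> {1} \<union> ({1..} - {1..N})"
    proof
      fix n assume n: "n \<in> S"
      show "n \<in> {1} \<union> ({1..} - {1..N})"
      proof (rule ccontr)
        assume "n \<notin> {1} \<union> ({1..} - {1..N})"
        with n have "n \<noteq> 1" "n \<le> N" "n > 0" by (auto simp: S_def)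
        then obtain p where "prime p" "p dvd n" using prime_factor_nat by blast
        moreover from this have "p \<le> N" using dvd_imp_le[of p n] \<open>n \<le> N\<close> \<open>n > 0\<close> by simp
        ultimately show False using n by (auto simp: S_def)
      qed
    qed
    have one: "(f has_sum 1) {1}" using has_sum_finite[of "{1}" f] by (simp add: f_def)
    have "(\<Sum>n=1..N. f n) = (\<Sum>n<N. f (Suc n))"
      by (simp add: sum.atLeast1_atMost_eq)
    with has_sum_Diff[OF f has_sum_finite[of "{1..N}"]]
    have "(f has_sum (zeta s - (\<Sum>n<N. f (Suc n)))) ({1..} - {1..N})" by auto
    from has_sum_Un_disjoint[OF one this] N
    have "(f has_sum (1 + (zeta s - (\<Sum>n<N. f (Suc n))))) ({1} \<union> ({1..} - {1..N}))" by auto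
    from has_sum_mono2[OF S this sub] have "Z N \<le> 1 + (zeta s - (\<Sum>n<N. f (Suc n)))"
      by (auto simp: f_def)
    moreover have "{1} \<subseteq> S" by (auto simp: S_def)
    from has_sum_mono2[OF one S this] have "1 \<le> Z N" by (auto simp: f_def)
    ultimately show ?thesis by blast
  qed
  have "summable (\<lambda>n. f (Suc n))"
    using summable_inverse_powr[OF s] summable_Suc_iff[of f] by (simp add: f_def)
  then have "(\<lambda>N. \<Sum>n<N. f (Suc n)) \<longlonglongrightarrow> zeta s"
    unfolding zeta_def f_def by (rule summable_LIMSEQ)
  then have lim: "(\<lambda>N. 1 + (zeta s - (\<Sum>n<N. f (Suc n)))) \<longlonglongrightarrow> 1"
    by (auto intro!: tendsto_eq_intros)
  have "Z \<longlonglongrightarrow> 1"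
    by (rule tendsto_sandwich[OF _ _ tendsto_const lim])
       (use bounds in \<open>auto simp: eventually_sequentially intro!: exI[of _ 1]\<close>)
  then show ?thesis unfolding Z_def [abs_def] .
qed

section \<open>Closed forms of the local factors\<close>

text \<open>Vectors with maximum \<open>m\<close> form the box of size \<open>m\<close> minus the
  previous box, and sums over boxes factor. At \<open>m = 0\<close> the subtracted power is
  \<open>0 ^ k\<close>, which vanishes as \<open>k \<ge> 1\<close>.\<close>

lemma sum_exps_max:
  fixes u y :: real
  assumes "k \<ge> 1"
  shows "(\<Sum>\<nu>\<in>exps k M. y ^ (MAX i\<in>{1..k}. \<nu> i) * (\<Prod>i=1..k. u ^ \<nu> i)) =
    (\<Sum>m\<le>M. y ^ m * ((\<Sum>a<Suc m. u ^ a) ^ k - (\<Sum>a<m. u ^ a) ^ k))"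
proof (induction M)
  case 0
  have Max0: "(MAX i\<in>{1..k}. \<nu> i) = 0" if "\<nu> \<in> exps k 0" for \<nu>
    using exps_le[OF that] assms by (intro Max_eqI) (auto simp: image_iff)
  have "(\<Sum>\<nu>\<in>exps k 0. y ^ (MAX i\<in>{1..k}. \<nu> i) * (\<Prod>i=1..k. u ^ \<nu> i)) = (\<Sum>\<nu>\<in>exps k 0. \<Prod>i=1..k. u ^ \<nu> i)"
    by (intro sum.cong refl) (simp add: Max0 del: One_nat_def)
  also have "\<dots> = 1" by (subst sum_exps_prod) simp
  finally show ?case using assms by simp
next
  case (Suc M)
  define T where "T M = (\<Sum>\<nu>\<in>exps k M. y ^ (MAX i\<in>{1..k}. \<nu> i) * (\<Prod>i=1..k. u ^ \<nu> i))" for M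
  define G where "G M = (\<Sum>\<nu>\<in>exps k M. \<Prod>i=1..k. u ^ \<nu> i)" for M
  have G: "G m = (\<Sum>a<Suc m. u ^ a) ^ k" for m
    unfolding G_def by (subst sum_exps_prod) (simp add: lessThan_Suc_atMost)
  have sub: "exps k M \<subseteq> exps k (Suc M)" by (rule exps_mono) simp
  have "T (Suc M) - T M = (\<Sum>\<nu>\<in>exps k (Suc M) - exps k M. y ^ (MAX i\<in>{1..k}. \<nu> i) * (\<Prod>i=1..k. u ^ \<nu> i))"
    unfolding T_def by (rule sum_diff [symmetric]) (use sub in auto)
  also have "\<dots> = (\<Sum>\<nu>\<in>exps k (Suc M) - exps k M. y ^ Suc M * (\<Prod>i=1..k. u ^ \<nu> i))"
  proof (intro sum.cong refl arg_cong2[where f = "(*)"] arg_cong2[where f = "(^)"])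
    fix \<nu> assume \<nu>: "\<nu> \<in> exps k (Suc M) - exps k M"
    then have "\<exists>i\<in>{1..k}. \<nu> i > M"
      by (force simp: exps_def PiE_iff)
    then obtain i where "i \<in> {1..k}" "\<nu> i = Suc M"
      using exps_le[of \<nu> k "Suc M"] \<nu> by (force simp: Suc_le_eq le_Suc_eq)
    then have "Suc M \<in> \<nu> ` {1..k}" by (metis imageI)
    then show "(MAX i\<in>{1..k}. \<nu> i) = Suc M"
      using exps_le[of \<nu> k "Suc M"] \<nu> by (intro Max_eqI) auto
  qed
  also have "\<dots> = y ^ Suc M * (G (Suc M) - G M)"
    unfolding G_def sum_distrib_left [symmetric] by (subst sum_diff) (use sub in auto)
  finally show ?case using Suc unfolding G T_def by (simp add: algebra_simps)
qed

text \<open>The binomial theorem for \<open>(1 - u ^ m) ^ k\<close> turns the series into a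
  combination of geometric series with ratios \<open>y * u ^ j\<close>.\<close>

lemma max_series_sums:
  fixes u y :: real
  assumes u: "\<bar>u\<bar> < 1" and yu: "\<And>j. 1 \<le> j \<Longrightarrow> j \<le> k \<Longrightarrow> \<bar>y * u ^ j\<bar> < 1"
  shows "(\<lambda>m. y ^ m * ((\<Sum>a<Suc m. u ^ a) ^ k - (\<Sum>a<m. u ^ a) ^ k)) sums
    ((\<Sum>j=1..k. real (k choose j) * (-1) ^ (j + 1) * ((1 - u ^ j) / (1 - y * u ^ j))) / (1 - u) ^ k)"
proof -
  define c where "c j = real (k choose j) * (-1) ^ (j + 1) * (1 - u ^ j)" for j
  have u1: "u \<noteq> 1" using u by auto
  have pow: "(\<Sum>a<m. u ^ a) ^ k = (\<Sum>j\<le>k. real (k choose j) * (-1) ^ j * (u ^ j) ^ m) / (1 - u) ^ k" for m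
  proof -
    have "(\<Sum>a<m. u ^ a) = (1 - u ^ m) / (1 - u)"
      using u1 by (simp add: sum_gp_strict)
    moreover have "(1 - u ^ m) ^ k = (\<Sum>j\<le>k. real (k choose j) * (-1) ^ j * (u ^ j) ^ m)"
      using binomial_ring[of "- (u ^ m)" 1 k]
      by (simp add: power_minus[of "u ^ m"] power_mult [symmetric] mult.commute[of m] mult.assoc)
    ultimately show ?thesis by (simp add: power_divide)
  qed
  have "(\<lambda>m. \<Sum>j=1..k. c j * (y * u ^ j) ^ m) sums (\<Sum>j=1..k. c j * (1 / (1 - y * u ^ j)))"
    using yu by (intro sums_sum sums_mult geometric_sums) auto
  then have "(\<lambda>m. (\<Sum>j=1..k. c j * (y * u ^ j) ^ m) / (1 - u) ^ k) sums
      ((\<Sum>j=1..k. c j * (1 / (1 - y * u ^ j))) / (1 - u) ^ k)"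
    by (rule sums_divide)
  moreover have "(\<Sum>j=1..k. c j * (y * u ^ j) ^ m) / (1 - u) ^ k
      = y ^ m * ((\<Sum>a<Suc m. u ^ a) ^ k - (\<Sum>a<m. u ^ a) ^ k)" for m
  proof -
    have "y ^ m * ((\<Sum>j\<le>k. real (k choose j) * (-1) ^ j * (u ^ j) ^ Suc m)
        - (\<Sum>j\<le>k. real (k choose j) * (-1) ^ j * (u ^ j) ^ m)) = (\<Sum>j\<le>k. c j * (y * u ^ j) ^ m)"
      unfolding sum_subtractf [symmetric] sum_distrib_left c_def
      by (intro sum.cong) (auto simp: algebra_simps power_mult_distrib)
    \<comment> \<open>The coefficient at \<open>j = 0\<close> is 0, as that part is constant under
      the difference. This is essential: its ratio \<open>y\<close> need not be below 1.\<close>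
    also have "\<dots> = (\<Sum>j=1..k. c j * (y * u ^ j) ^ m)"
      by (intro sum.mono_neutral_right) (auto simp: c_def not_less_eq_eq)
    finally show ?thesis unfolding pow by (simp only: diff_divide_distrib [symmetric] times_divide_eq_right)
  qed
  ultimately show ?thesis by (simp add: c_def)
qed

text \<open>With \<open>y = real p powr r\<close> a local term is \<open>y\<close> to the maximum
  times \<open>u\<close> to the sum. As \<open>y * u = z\<close>, the ratios
  \<open>y * u ^ j\<close> equal \<open>z * u ^ (j - 1)\<close> and are below 1 for
  \<open>j \<ge> 1\<close>.\<close>

lemma local_factor_eq:
  assumes r: "r > -1" and k: "k \<ge> 1" and p: "p \<ge> 2"
  defines "z \<equiv> 1 / real p" and "u \<equiv> real p powr - (r + 1)"
  shows "local_factor r k p = (1 - z) ^ k *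
    ((\<Sum>j=1..k. real (k choose j) * (-1) ^ (j + 1) * ((1 - u ^ j) / (1 - z * u ^ (j - 1)))) / (1 - u) ^ k)"
proof -
  define y where "y = real p powr r"
  have u: "0 < u" "u < 1" unfolding u_def using r p by (auto intro!: powr_less_one)
  have z: "0 < z" "z < 1" using p by (auto simp: z_def)
  have yu: "y * u = z"
  proof -
    have "y * u = real p powr (- 1)" unfolding y_def u_def powr_add [symmetric] by simp
    then show ?thesis using p by (simp add: z_def powr_minus divide_inverse)
  qed
  have yuj: "y * u ^ j = z * u ^ (j - 1)" if "1 \<le> j" for j
    using that yu by (cases j) (simp_all add: mult.assoc [symmetric])
  have lt: "local_term r k p \<nu> = y ^ (MAX i\<in>{1..k}. \<nu> i) * (\<Prod>i=1..k. u ^ \<nu> i)" for \<nu>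
  proof -
    have "y ^ a = real p powr (r * real a)" "u ^ a = real p powr (- ((r + 1) * real a))" for a
      using p unfolding y_def u_def by (simp_all add: powr_realpow [symmetric] powr_powr minus_mult_left)
    then show ?thesis unfolding power_sum [symmetric]
      by (simp add: local_term_def powr_minus divide_inverse del: of_nat_sum)
  qed
  have "sum (local_term r k p) (exps k M) = (\<Sum>m\<le>M. y ^ m * ((\<Sum>a<Suc m. u ^ a) ^ k - (\<Sum>a<m. u ^ a) ^ k))" for M
    unfolding lt by (rule sum_exps_max[OF k])
  moreover have "(\<lambda>m. y ^ m * ((\<Sum>a<Suc m. u ^ a) ^ k - (\<Sum>a<m. u ^ a) ^ k)) sums
    ((\<Sum>j=1..k. real (k choose j) * (-1) ^ (j + 1) * ((1 - u ^ j) / (1 - y * u ^ j))) / (1 - u) ^ k)"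
  proof (rule max_series_sums)
    fix j :: nat assume j: "1 \<le> j"
    have "z * u ^ (j - 1) \<le> z" using u z by (intro mult_left_le power_le_one) auto
    with z(2) have "z * u ^ (j - 1) < 1" by linarith
    then show "\<bar>y * u ^ j\<bar> < 1" unfolding yuj[OF j] using u z by (simp add: abs_mult)
  qed (use u in auto)
  ultimately have "(\<lambda>M. sum (local_term r k p) (exps k M)) \<longlonglongrightarrow>
      (\<Sum>j=1..k. real (k choose j) * (-1) ^ (j + 1) * ((1 - u ^ j) / (1 - y * u ^ j))) / (1 - u) ^ k"
    unfolding sums_def_le by simp
  from LIMSEQ_unique[OF local_term_partial_sums[OF r k p] this]
  have "infsum (local_term r k p) ({1..k} \<rightarrow>\<^sub>E UNIV) =
      (\<Sum>j=1..k. real (k choose j) * (-1) ^ (j + 1) * ((1 - u ^ j) / (1 - z * u ^ (j - 1)))) / (1 - u) ^ k"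
    by (simp add: yuj)
  then show ?thesis unfolding local_factor_def z_def by simp
qed

section \<open>Closed forms in three and four variables\<close>

lemma inverse_powr_eq:
  assumes "p \<ge> 2" "e = real a * (r + 1) + real b"
  shows "1 / real p powr e = (1 / real p) ^ b * (real p powr - (r + 1)) ^ a"
proof -
  have "1 / real p powr e = real p powr (- real b) * real p powr (- (r + 1) * real a)"
    unfolding powr_add [symmetric] powr_minus_divide [symmetric] assms(2) by (simp add: algebra_simps)
  also have "real p powr (- real b) = (1 / real p) ^ b"
    using assms by (simp add: powr_minus_divide powr_realpow power_one_over)
  also have "real p powr (- (r + 1) * real a) = (real p powr - (r + 1)) ^ a"
    unfolding powr_powr [symmetric] using assms by (subst powr_realpow) auto
  finally show ?thesis .
qed

text \<open>One factor \<open>1 - z\<close> and the two factors on the second line clear the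
  denominators. The numerator is then divisible by \<open>(1 - u) ^ 3\<close>, and the quotient is
  \<open>factor3\<close> in terms of \<open>z = 1 / real p\<close> and
  \<open>u = real p powr - (r + 1)\<close>.\<close>

lemma closed_form3:
  fixes z u :: real
  assumes "z \<noteq> 1" "u \<noteq> 1" "z * u \<noteq> 1" "z * u ^ 2 \<noteq> 1"
  shows "(1 - z) ^ 3 * ((3 * ((1 - u) / (1 - z)) - 3 * ((1 - u ^ 2) / (1 - z * u)) + (1 - u ^ 3) / (1 - z * u ^ 2)) / (1 - u) ^ 3)
      * ((1 - z * u) * (1 - z * u ^ 2))
    = 1 - 3 * z ^ 2 + 2 * z ^ 3 + 2 * (z * u) - 3 * (z ^ 2 * u) + z ^ 4 * u"
proof -
  define a b c e where "a = 1 - z" and "b = 1 - z * u" and "c = 1 - z * u ^ 2" and "e = 1 - u"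
  have nz: "a \<noteq> 0" "b \<noteq> 0" "c \<noteq> 0" "e \<noteq> 0"
    using assms by (auto simp: a_def b_def c_def e_def)
  have "a ^ 3 * ((3 * ((1 - u) / a) - 3 * ((1 - u ^ 2) / b) + (1 - u ^ 3) / c) / e ^ 3) * (b * c)
     = a ^ 2 * (3 * (1 - u) * b * c - 3 * (1 - u ^ 2) * a * c + (1 - u ^ 3) * a * b) / e ^ 3"
    using nz by (simp add: field_simps power2_eq_square power3_eq_cube)
  also have "a ^ 2 * (3 * (1 - u) * b * c - 3 * (1 - u ^ 2) * a * c + (1 - u ^ 3) * a * b) =
     e ^ 3 * (1 - 3 * z ^ 2 + 2 * z ^ 3 + 2 * (z * u) - 3 * (z ^ 2 * u) + z ^ 4 * u)"
    unfolding a_def b_def c_def e_def by algebra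
  finally show ?thesis using nz by (simp add: a_def b_def c_def e_def)
qed

lemma closed_form4:
  fixes z u :: real
  assumes "z \<noteq> 1" "u \<noteq> 1" "z * u \<noteq> 1" "z * u ^ 2 \<noteq> 1" "z * u ^ 3 \<noteq> 1"
  shows "(1 - z) ^ 4 * ((4 * ((1 - u) / (1 - z)) - 6 * ((1 - u ^ 2) / (1 - z * u)) + 4 * ((1 - u ^ 3) / (1 - z * u ^ 2))
        - (1 - u ^ 4) / (1 - z * u ^ 3)) / (1 - u) ^ 4)
      * ((1 - z * u) * (1 - z * u ^ 2) * (1 - z * u ^ 3))
    = 1 - 6 * z ^ 2 + 8 * z ^ 3 - 3 * z ^ 4
       + 5 * (z * u) - 12 * (z ^ 2 * u) + 6 * (z ^ 3 * u) + 4 * (z ^ 4 * u) - 3 * (z ^ 5 * u)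
       + 3 * (z * u ^ 2) - 4 * (z ^ 2 * u ^ 2) - 6 * (z ^ 3 * u ^ 2) + 12 * (z ^ 4 * u ^ 2) - 5 * (z ^ 5 * u ^ 2)
       + 3 * (z ^ 2 * u ^ 3) - 8 * (z ^ 3 * u ^ 3) + 6 * (z ^ 4 * u ^ 3) - z ^ 6 * u ^ 3" (is "_ = ?R")
proof -
  define a b c d e where "a = 1 - z" and "b = 1 - z * u" and "c = 1 - z * u ^ 2" and "d = 1 - z * u ^ 3" and "e = 1 - u"
  have nz: "a \<noteq> 0" "b \<noteq> 0" "c \<noteq> 0" "d \<noteq> 0" "e \<noteq> 0"
    using assms by (auto simp: a_def b_def c_def d_def e_def)
  have "a ^ 4 * ((4 * ((1 - u) / a) - 6 * ((1 - u ^ 2) / b) + 4 * ((1 - u ^ 3) / c) - (1 - u ^ 4) / d) / e ^ 4) * (b * c * d)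
     = a ^ 3 * (4 * (1 - u) * b * c * d - 6 * (1 - u ^ 2) * a * c * d + 4 * (1 - u ^ 3) * a * b * d - (1 - u ^ 4) * a * b * c) / e ^ 4"
    using nz by (simp add: field_simps power4_eq_xxxx power3_eq_cube)
  also have "a ^ 3 * (4 * (1 - u) * b * c * d - 6 * (1 - u ^ 2) * a * c * d + 4 * (1 - u ^ 3) * a * b * d - (1 - u ^ 4) * a * b * c)
     = e ^ 4 * ?R"
    unfolding a_def b_def c_def d_def e_def by algebra
  finally show ?thesis using nz by (simp add: a_def b_def c_def d_def e_def)
qed

text \<open>The multipliers are \<open>1 - z * u\<close> and \<open>1 - z * u ^ 2\<close>, the Euler
  factors of the reciprocals of \<open>zeta (r + 2)\<close> and
  \<open>zeta (2 * r + 3)\<close>.\<close>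

lemma factor3_eq:
  assumes r: "r > -1" and p: "p \<ge> 2"
  shows "factor3 r p = local_factor r 3 p * ((1 - 1 / real p powr (r + 2)) * (1 - 1 / real p powr (2 * r + 3)))"
proof -
  define z u where "z = 1 / real p" and "u = real p powr - (r + 1)"
  have zu: "0 < z" "z < 1" "0 < u" "u < 1"
    using r p by (auto simp: z_def u_def intro!: powr_less_one)
  have "z * u ^ j < 1" for j
    using zu by (intro order.strict_trans1[OF mult_left_le[of "u ^ j" z]] power_le_one) auto
  from this[of 1] this[of 2] have nz: "z \<noteq> 1" "u \<noteq> 1" "z * u \<noteq> 1" "z * u ^ 2 \<noteq> 1"
    using zu by auto
  note pw = inverse_powr_eq[OF p, of _ _ r, folded z_def u_def]
  have e: "1 / real p powr (r + 2) = z ^ 1 * u ^ 1" "1 / real p powr (r + 3) = z ^ 2 * u ^ 1"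
    "1 / real p powr (r + 5) = z ^ 4 * u ^ 1" "1 / real p powr (2 * r + 3) = z ^ 1 * u ^ 2"
    by (rule pw; simp)+
  have c: "numeral w / real p powr s = numeral w * (1 / real p powr s)" "numeral w / real p ^ n = numeral w * z ^ n" for w s n
    by (simp_all add: z_def power_one_over)
  have sum: "(\<Sum>j=1..3. real (3 choose j) * (-1) ^ (j + 1) * ((1 - u ^ j) / (1 - z * u ^ (j - 1)))) =
     3 * ((1 - u) / (1 - z)) - 3 * ((1 - u ^ 2) / (1 - z * u)) + (1 - u ^ 3) / (1 - z * u ^ 2)"
  proof -
    define A where "A j = (1 - u ^ j) / (1 - z * u ^ (j - 1))" for j
    have "{1..3::nat} = {1, 2, 3}" "(3::nat) choose 2 = 3" by (auto simp: eval_nat_numeral)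
    then have "(\<Sum>j=1..3. real (3 choose j) * (-1) ^ (j + 1) * A j) = 3 * A 1 - 3 * A 2 + A 3" by simp
    then show ?thesis by (simp add: A_def)
  qed
  have "factor3 r p = 1 - 3 * z ^ 2 + 2 * z ^ 3 + 2 * (z * u) - 3 * (z ^ 2 * u) + z ^ 4 * u"
    unfolding factor3_def c e by simp
  also have "\<dots> = local_factor r 3 p * ((1 - z * u) * (1 - z * u ^ 2))"
    unfolding closed_form3[OF nz, symmetric] using local_factor_eq[OF r _ p, of 3, folded z_def u_def]
    by (simp only: sum)
  finally show ?thesis unfolding e by simp
qed

lemma factor4_eq:
  assumes r: "r > -1" and p: "p \<ge> 2"
  shows "factor4 r p = local_factor r 4 p * ((1 - 1 / real p powr (r + 2)) * (1 - 1 / real p powr (2 * r + 3)) *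
    (1 - 1 / real p powr (3 * r + 4)))"
proof -
  define z u where "z = 1 / real p" and "u = real p powr - (r + 1)"
  have zu: "0 < z" "z < 1" "0 < u" "u < 1"
    using r p by (auto simp: z_def u_def intro!: powr_less_one)
  have "z * u ^ j < 1" for j
    using zu by (intro order.strict_trans1[OF mult_left_le[of "u ^ j" z]] power_le_one) auto
  from this[of 1] this[of 2] this[of 3]
  have nz: "z \<noteq> 1" "u \<noteq> 1" "z * u \<noteq> 1" "z * u ^ 2 \<noteq> 1" "z * u ^ 3 \<noteq> 1"
    using zu by auto
  note pw = inverse_powr_eq[OF p, of _ _ r, folded z_def u_def]
  have e: "1 / real p powr (r + 2) = z ^ 1 * u ^ 1" "1 / real p powr (r + 3) = z ^ 2 * u ^ 1"
    "1 / real p powr (r + 4) = z ^ 3 * u ^ 1" "1 / real p powr (r + 5) = z ^ 4 * u ^ 1"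
    "1 / real p powr (r + 6) = z ^ 5 * u ^ 1"
    "1 / real p powr (2 * r + 3) = z ^ 1 * u ^ 2" "1 / real p powr (2 * r + 4) = z ^ 2 * u ^ 2"
    "1 / real p powr (2 * r + 5) = z ^ 3 * u ^ 2" "1 / real p powr (2 * r + 6) = z ^ 4 * u ^ 2"
    "1 / real p powr (2 * r + 7) = z ^ 5 * u ^ 2"
    "1 / real p powr (3 * r + 4) = z ^ 1 * u ^ 3" "1 / real p powr (3 * r + 5) = z ^ 2 * u ^ 3"
    "1 / real p powr (3 * r + 6) = z ^ 3 * u ^ 3" "1 / real p powr (3 * r + 7) = z ^ 4 * u ^ 3"
    "1 / real p powr (3 * r + 9) = z ^ 6 * u ^ 3"
    by (rule pw; simp)+
  have c: "numeral w / real p powr s = numeral w * (1 / real p powr s)" "numeral w / real p ^ n = numeral w * z ^ n" for w s n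
    by (simp_all add: z_def power_one_over)
  have sum: "(\<Sum>j=1..4. real (4 choose j) * (-1) ^ (j + 1) * ((1 - u ^ j) / (1 - z * u ^ (j - 1)))) =
     4 * ((1 - u) / (1 - z)) - 6 * ((1 - u ^ 2) / (1 - z * u)) + 4 * ((1 - u ^ 3) / (1 - z * u ^ 2))
       - (1 - u ^ 4) / (1 - z * u ^ 3)"
  proof -
    define A where "A j = (1 - u ^ j) / (1 - z * u ^ (j - 1))" for j
    have "{1..4::nat} = {1, 2, 3, 4}" "(4::nat) choose 2 = 6" "(4::nat) choose 3 = 4" by (auto simp: eval_nat_numeral)
    then have "(\<Sum>j=1..4. real (4 choose j) * (-1) ^ (j + 1) * A j) = 4 * A 1 - 6 * A 2 + 4 * A 3 - A 4" by simp
    then show ?thesis by (simp add: A_def)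
  qed
  have "factor4 r p = 1 - 6 * z ^ 2 + 8 * z ^ 3 - 3 * z ^ 4
       + 5 * (z * u) - 12 * (z ^ 2 * u) + 6 * (z ^ 3 * u) + 4 * (z ^ 4 * u) - 3 * (z ^ 5 * u)
       + 3 * (z * u ^ 2) - 4 * (z ^ 2 * u ^ 2) - 6 * (z ^ 3 * u ^ 2) + 12 * (z ^ 4 * u ^ 2) - 5 * (z ^ 5 * u ^ 2)
       + 3 * (z ^ 2 * u ^ 3) - 8 * (z ^ 3 * u ^ 3) + 6 * (z ^ 4 * u ^ 3) - z ^ 6 * u ^ 3"
    unfolding factor4_def c e by simp
  also have "\<dots> = local_factor r 4 p * ((1 - z * u) * (1 - z * u ^ 2) * (1 - z * u ^ 3))"
    unfolding closed_form4[OF nz, symmetric] using local_factor_eq[OF r _ p, of 4, folded z_def u_def]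
    by (simp only: sum)
  finally show ?thesis unfolding e by simp
qed

section \<open>Passage to the Euler product\<close>

lemma prod_on_primes:
  "(\<Prod>i\<le>N. on_primes f i) = (\<Prod>p\<in>{p. p \<le> N \<and> prime p}. f p)"
proof -
  have "(\<Prod>p\<in>{p. p \<le> N \<and> prime p}. f p) = (\<Prod>p\<in>{p\<in>{..N}. prime p}. f p)" by simp
  also have "\<dots> = (\<Prod>i\<le>N. on_primes f i)"
    unfolding on_primes_def by (rule prod.inter_filter) simp
  finally show ?thesis ..
qed

lemma prime_prod_LIMSEQ:
  "prime_prod_converges f \<Longrightarrow> (\<lambda>N. \<Prod>p\<in>{p. p \<le> N \<and> prime p}. f p) \<longlonglongrightarrow> prime_prod f"
  unfolding prime_prod_converges_def prime_prod_def prod_on_primes [symmetric]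
  by (rule convergent_prod_LIMSEQ)

lemma prime_prod_converges_if_near_1:
  assumes "\<And>p. prime p \<Longrightarrow> \<bar>f p - 1\<bar> \<le> A * real p powr - s" "s > 1" "A \<ge> 0"
  shows "prime_prod_converges f"
proof -
  have "summable (\<lambda>n. A * real n powr - s)"
    using assms(2) by (intro summable_mult) (simp add: summable_real_powr_iff)
  then have "summable (\<lambda>n. \<bar>on_primes f n - 1\<bar>)"
  proof (rule summable_comparison_test'[where N = 0])
    show "norm \<bar>on_primes f n - 1\<bar> \<le> A * real n powr - s" for n
      using assms by (simp add: on_primes_def)
  qed
  then show ?thesis unfolding prime_prod_converges_def
    by (intro abs_convergent_prod_imp_convergent_prod summable_imp_abs_convergent_prod) simp
qed

lemma on_primes_mult:
  "on_primes (\<lambda>p. f p * g p) = (\<lambda>n. on_primes f n * on_primes g n)"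
  by (auto simp: on_primes_def)

lemma prime_prod_mult:
  assumes "prime_prod_converges f" "prime_prod_converges g"
  shows "prime_prod_converges (\<lambda>p. f p * g p)"
    and "prime_prod (\<lambda>p. f p * g p) = prime_prod f * prime_prod g"
  using assms unfolding prime_prod_converges_def prime_prod_def on_primes_mult
  by (auto intro: convergent_prod_mult simp: prodinf_mult)

lemma on_primes_cong: "(\<And>p. prime p \<Longrightarrow> f p = g p) \<Longrightarrow> on_primes f = on_primes g"
  by (auto simp: on_primes_def)

lemma prime_prod_zeta:
  assumes "s > 1"
  shows "prime_prod_converges (\<lambda>p. 1 - 1 / real p powr s)"
    and "zeta s * prime_prod (\<lambda>p. 1 - 1 / real p powr s) = 1"
proof -
  show conv: "prime_prod_converges (\<lambda>p. 1 - 1 / real p powr s)"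
    by (rule prime_prod_converges_if_near_1[of _ 1 s]) (use assms in \<open>auto simp: powr_minus_divide\<close>)
  show "zeta s * prime_prod (\<lambda>p. 1 - 1 / real p powr s) = 1"
    by (rule LIMSEQ_unique[OF tendsto_mult[OF tendsto_const prime_prod_LIMSEQ[OF conv]] zeta_Euler_product[OF assms]])
qed

lemma local_factor_converges:
  assumes "r > -1" "k \<ge> 1"
  shows "prime_prod_converges (local_factor r k)"
proof (rule prime_prod_converges_if_near_1)
  show "\<bar>local_factor r k p - 1\<bar> \<le> local_const r k * real p powr - (1 + saving r)" if "prime p" for p
    by (intro local_factor_near_1 assms prime_ge_2_nat that)
qed (use saving_bounds[OF assms(1)] local_const_nonneg[OF assms(1)] in auto)

text \<open>Each zeta value cancels against its own reciprocal Euler product inside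
  \<open>factor3\<close>, leaving the product of the local factors.\<close>

lemma prime_prod_factor3:
  assumes r: "r > -1"
  shows "prime_prod_converges (factor3 r)"
    and "C r 3 = zeta (r + 2) * zeta (2 * r + 3) * prime_prod (factor3 r)"
proof -
  define Z where "Z s = (\<lambda>p. 1 - 1 / real p powr s)" for s :: real
  have Z: "prime_prod_converges (Z s)" "zeta s * prime_prod (Z s) = 1" if "s > 1" for s
    using prime_prod_zeta[OF that] by (simp_all add: Z_def)
  have "on_primes (factor3 r) = on_primes (\<lambda>p. local_factor r 3 p * (Z (r + 2) p * Z (2 * r + 3) p))"
    using factor3_eq[OF r] by (intro on_primes_cong) (simp add: Z_def prime_ge_2_nat)
  then have eq: "prime_prod_converges (factor3 r) = prime_prod_converges (\<lambda>p. local_factor r 3 p * (Z (r + 2) p * Z (2 * r + 3) p))"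
    "prime_prod (factor3 r) = prime_prod (\<lambda>p. local_factor r 3 p * (Z (r + 2) p * Z (2 * r + 3) p))"
    by (simp_all add: prime_prod_converges_def prime_prod_def)
  show "prime_prod_converges (factor3 r)"
    unfolding eq by (intro prime_prod_mult Z local_factor_converges r) (use r in auto)
  have "prime_prod (factor3 r) = C r 3 * (prime_prod (Z (r + 2)) * prime_prod (Z (2 * r + 3)))"
    unfolding eq C_def using r
    by (subst prime_prod_mult, (intro prime_prod_mult Z local_factor_converges; simp)+)+ simp
  then have "zeta (r + 2) * zeta (2 * r + 3) * prime_prod (factor3 r) =
     C r 3 * (zeta (r + 2) * prime_prod (Z (r + 2))) * (zeta (2 * r + 3) * prime_prod (Z (2 * r + 3)))"
    by simp
  then show "C r 3 = zeta (r + 2) * zeta (2 * r + 3) * prime_prod (factor3 r)"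
    using r by (simp add: Z)
qed

lemma prime_prod_factor4:
  assumes r: "r > -1"
  shows "prime_prod_converges (factor4 r)"
    and "C r 4 = zeta (r + 2) * zeta (2 * r + 3) * zeta (3 * r + 4) * prime_prod (factor4 r)"
proof -
  define Z where "Z s = (\<lambda>p. 1 - 1 / real p powr s)" for s :: real
  have Z: "prime_prod_converges (Z s)" "zeta s * prime_prod (Z s) = 1" if "s > 1" for s
    using prime_prod_zeta[OF that] by (simp_all add: Z_def)
  have "on_primes (factor4 r) = on_primes (\<lambda>p. local_factor r 4 p * (Z (r + 2) p * Z (2 * r + 3) p * Z (3 * r + 4) p))"
    using factor4_eq[OF r] by (intro on_primes_cong) (simp add: Z_def prime_ge_2_nat)
  then have eq: "prime_prod_converges (factor4 r) = prime_prod_converges (\<lambda>p. local_factor r 4 p * (Z (r + 2) p * Z (2 * r + 3) p * Z (3 * r + 4) p))"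
    "prime_prod (factor4 r) = prime_prod (\<lambda>p. local_factor r 4 p * (Z (r + 2) p * Z (2 * r + 3) p * Z (3 * r + 4) p))"
    by (simp_all add: prime_prod_converges_def prime_prod_def)
  show "prime_prod_converges (factor4 r)"
    unfolding eq by (intro prime_prod_mult Z local_factor_converges r) (use r in auto)
  have "prime_prod (factor4 r) = C r 4 * (prime_prod (Z (r + 2)) * prime_prod (Z (2 * r + 3)) * prime_prod (Z (3 * r + 4)))"
    unfolding eq C_def using r
    by (subst prime_prod_mult, (intro prime_prod_mult Z local_factor_converges; simp)+)+ simp
  then have "zeta (r + 2) * zeta (2 * r + 3) * zeta (3 * r + 4) * prime_prod (factor4 r) =
     C r 4 * (zeta (r + 2) * prime_prod (Z (r + 2))) * (zeta (2 * r + 3) * prime_prod (Z (2 * r + 3)))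
       * (zeta (3 * r + 4) * prime_prod (Z (3 * r + 4)))"
    by simp
  then show "C r 4 = zeta (r + 2) * zeta (2 * r + 3) * zeta (3 * r + 4) * prime_prod (factor4 r)"
    using r by (simp add: Z)
qed

section \<open>The asymptotic formulas\<close>

lemma multiplicity_le_self:
  fixes n :: nat
  assumes "n > 0"
  shows "multiplicity p n \<le> n"
proof (cases "p \<ge> 2")
  case True
  have "multiplicity p n < 2 ^ multiplicity p n" by (rule less_exp)
  also have "\<dots> \<le> p ^ multiplicity p n" using True by (intro power_mono) auto
  also have "\<dots> \<le> n" using assms by (intro dvd_imp_le multiplicity_dvd)
  finally show ?thesis by simp
next
  case False
  \<comment> \<open>For \<open>p = 1\<close> all powers divide \<open>n\<close> and
    \<open>multiplicity\<close> takes its default value 0; for \<open>p = 0\<close> only the zeroth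
    power divides \<open>n\<close>.\<close>
  then have "p = 0 \<or> p = 1" by auto
  then show ?thesis by (auto simp: multiplicity_unit_left)
qed

text \<open>For fixed \<open>x\<close>, the limit in \<open>M\<close> completes the local factors
  and the limit in \<open>N\<close> completes the product to \<open>C r k\<close>; the uniform bound
  survives both.\<close>

lemma lcm_sum_asymp:
  assumes r: "r > -1" and t: "t > -1" "saving r \<le> min (t + 1) 1" and k: "k \<ge> 1"
  obtains K where "\<And>x. x > 0 \<Longrightarrow>
    \<bar>(\<Sum>n\<in>tuples_upto k x. lcm_ratio k n powr r * (\<Prod>i=1..k. real (n i) powr t)) -
      C r k * (x powr (t + 1) / (t + 1)) ^ k\<bar> \<le> K * x powr (real k * (t + 1) - saving r)"
proof -
  obtain K where K: "\<And>x P M. x > 0 \<Longrightarrow> finite P \<Longrightarrow> (\<And>p. p \<in> P \<Longrightarrow> prime p) \<Longrightarrow>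
    (\<And>n. 0 < n \<Longrightarrow> real n \<le> x \<Longrightarrow> prime_factors n \<subseteq> P \<and> (\<forall>p. multiplicity p n \<le> M)) \<Longrightarrow>
    \<bar>(\<Sum>n\<in>tuples_upto k x. lcm_ratio k n powr r * (\<Prod>i=1..k. real (n i) powr t)) -
      (x powr (t + 1) / (t + 1)) ^ k * (\<Prod>p\<in>P. local_sum r k p M)\<bar>
    \<le> K * x powr (real k * (t + 1) - saving r)"
    using lcm_sum_near_finite_product[OF assms] by blast
  show ?thesis
  proof (rule that)
    fix x :: real assume x: "x > 0"
    define S where "S = (\<Sum>n\<in>tuples_upto k x. lcm_ratio k n powr r * (\<Prod>i=1..k. real (n i) powr t))"
    define X where "X = (x powr (t + 1) / (t + 1)) ^ k"
    define B where "B = K * x powr (real k * (t + 1) - saving r)"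
    define P where "P N = {p. p \<le> N \<and> prime p}" for N :: nat
    have P: "finite (P N)" "p \<in> P N \<Longrightarrow> prime p" for N p by (auto simp: P_def)
    \<comment> \<open>Every \<open>n \<le> x\<close> satisfies \<open>n \<le> N \<le> M\<close>, so
      its prime factors are at most \<open>N\<close> and, crudely, its multiplicities at most
      \<open>M\<close>.\<close>
    have fin: "\<bar>S - X * (\<Prod>p\<in>P N. local_sum r k p M)\<bar> \<le> B" if "x \<le> real N" "N \<le> M" for N M
      unfolding S_def X_def B_def
    proof (rule K[OF x P])
      fix n :: nat assume n: "0 < n" "real n \<le> x"
      then have "n \<le> N" using that by linarith
      have "prime_factors n \<subseteq> P N"
      proof
        fix p assume p: "p \<in> prime_factors n"
        then have "p \<le> n" using n by (intro dvd_imp_le) (auto simp: in_prime_factors_iff)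
        with p \<open>n \<le> N\<close> show "p \<in> P N" by (auto simp: P_def in_prime_factors_iff)
      qed
      moreover have "multiplicity p n \<le> M" for p
        using multiplicity_le_self[OF n(1), of p] \<open>n \<le> N\<close> that by linarith
      ultimately show "prime_factors n \<subseteq> P N \<and> (\<forall>p. multiplicity p n \<le> M)" by blast
    qed
    have "\<bar>S - X * (\<Prod>p\<in>P N. local_factor r k p)\<bar> \<le> B" if "x \<le> real N" for N
    proof (rule tendsto_upperbound)
      show "(\<lambda>M. \<bar>S - X * (\<Prod>p\<in>P N. local_sum r k p M)\<bar>) \<longlonglongrightarrow> \<bar>S - X * (\<Prod>p\<in>P N. local_factor r k p)\<bar>"
        by (intro tendsto_rabs tendsto_diff tendsto_const tendsto_mult tendsto_prod local_sum_tendsto r k)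
           (auto simp: P_def prime_ge_2_nat)
      show "\<forall>\<^sub>F M in sequentially. \<bar>S - X * (\<Prod>p\<in>P N. local_sum r k p M)\<bar> \<le> B"
        using fin[OF that] unfolding eventually_sequentially by blast
    qed auto
    moreover have "\<forall>\<^sub>F N in sequentially. x \<le> real N"
      by (rule eventually_sequentiallyI[of "nat \<lceil>x\<rceil>"]) linarith
    ultimately have ev: "\<forall>\<^sub>F N in sequentially. \<bar>S - X * (\<Prod>p\<in>P N. local_factor r k p)\<bar> \<le> B"
      by (rule_tac eventually_mono) 
    have "(\<lambda>N. \<bar>S - X * (\<Prod>p\<in>P N. local_factor r k p)\<bar>) \<longlonglongrightarrow> \<bar>S - X * C r k\<bar>"
      unfolding P_def C_def
      by (intro tendsto_rabs tendsto_diff tendsto_const tendsto_mult prime_prod_LIMSEQ local_factor_converges r k)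
    from tendsto_upperbound[OF this ev] have "\<bar>S - X * C r k\<bar> \<le> B" by simp
    then show "\<bar>(\<Sum>n\<in>tuples_upto k x. lcm_ratio k n powr r * (\<Prod>i=1..k. real (n i) powr t)) -
      C r k * (x powr (t + 1) / (t + 1)) ^ k\<bar> \<le> K * x powr (real k * (t + 1) - saving r)"
      by (simp add: S_def X_def B_def mult.commute)
  qed
qed

text \<open>From \<open>x = 1\<close> on the larger exponent dominates; the sign of \<open>K\<close>
  is unknown, hence \<open>\<bar>K\<bar>\<close>.\<close>

lemma bigo_powr_weaken:
  fixes f :: "real \<Rightarrow> real"
  assumes "\<And>x. x > 0 \<Longrightarrow> \<bar>f x\<bar> \<le> K * x powr a" "a \<le> b"
  shows "f \<in> O[at_top](\<lambda>x. x powr b)"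
proof (rule bigoI[of _ "\<bar>K\<bar>"])
  show "\<forall>\<^sub>F x in at_top. norm (f x) \<le> \<bar>K\<bar> * norm (x powr b)"
    using eventually_ge_at_top[of 1]
  proof eventually_elim
    case (elim x)
    have "\<bar>f x\<bar> \<le> K * x powr a" using elim by (intro assms) auto
    also have "\<dots> \<le> \<bar>K\<bar> * x powr b"
      using elim assms(2) by (intro mult_mono powr_mono) auto
    finally show ?case by simp
  qed
qed

theorem corollary1:
  fixes k :: nat and r :: real
  assumes "k \<ge> 3" and "r > -1"
  shows
    "(\<forall>p. prime p \<longrightarrow> local_term r k p summable_on ({1..k} \<rightarrow>\<^sub>E UNIV))
     \<and> prime_prod_converges (local_factor r k)
     \<and> (\<forall>\<epsilon>>0.
          (\<lambda>x::real. (\<Sum>n\<in>tuples_upto k x. real (lcm_tuple k n) powr r)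
             - C r k * (x powr (real k * (r + 1)) / (r + 1) ^ k))
          \<in> O[at_top](\<lambda>x. x powr (real k * (r + 1) - 1/2 * min (r + 1) 1 + \<epsilon>)))
     \<and> (\<forall>\<epsilon>>0.
          (\<lambda>x::real. (\<Sum>n\<in>tuples_upto k x.
               (real (lcm_tuple k n) / real (\<Prod>i=1..k. n i)) powr r)
             - C r k * x ^ k)
          \<in> O[at_top](\<lambda>x. x powr (real k - 1/2 * min (r + 1) 1 + \<epsilon>)))
     \<and> prime_prod_converges (factor3 r)
     \<and> C r 3 = zeta (r + 2) * zeta (2 * r + 3) * prime_prod (factor3 r)
     \<and> prime_prod_converges (factor4 r)
     \<and> C r 4 = zeta (r + 2) * zeta (2 * r + 3) * zeta (3 * r + 4) * prime_prod (factor4 r)"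
proof (intro conjI allI impI)
  note r = \<open>r > -1\<close>
  have k: "k \<ge> 1" using assms(1) by simp
  note sv = saving_bounds[OF r]
  show "local_term r k p summable_on ({1..k} \<rightarrow>\<^sub>E UNIV)" if "prime p" for p
    by (intro local_term_summable r k prime_ge_2_nat that)
  show "prime_prod_converges (local_factor r k)" by (rule local_factor_converges[OF r k])
  have pos: "n i > 0" if "n \<in> tuples_upto k x" "i \<in> {1..k}" for n i x
    using that by (auto simp: tuples_upto_def PiE_iff)
  have half: "1/2 * min (r + 1) 1 = saving r" by (simp add: saving_def)
  fix \<epsilon> :: real assume \<epsilon>: "\<epsilon> > 0"
  then have le: "a - saving r \<le> a - 1/2 * min (r + 1) 1 + \<epsilon>" for a :: real
    unfolding half by linarith
  show "(\<lambda>x::real. (\<Sum>n\<in>tuples_upto k x. real (lcm_tuple k n) powr r)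
             - C r k * (x powr (real k * (r + 1)) / (r + 1) ^ k))
          \<in> O[at_top](\<lambda>x. x powr (real k * (r + 1) - 1/2 * min (r + 1) 1 + \<epsilon>))"
  proof -
    have "saving r \<le> min (r + 1) 1"
    proof -
      have "min (r + 1) 1 = 2 * saving r" by (simp add: saving_def)
      then show ?thesis using sv(1) by linarith
    qed
    then obtain K where K: "\<And>x. x > 0 \<Longrightarrow>
      \<bar>(\<Sum>n\<in>tuples_upto k x. lcm_ratio k n powr r * (\<Prod>i=1..k. real (n i) powr r)) -
        C r k * (x powr (r + 1) / (r + 1)) ^ k\<bar> \<le> K * x powr (real k * (r + 1) - saving r)"
      using lcm_sum_asymp[OF r r _ k] by blast
    \<comment> \<open>The choice \<open>t = r\<close>: the weights cancel the denominator of the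
      ratio and leave the least common multiple alone.\<close>
    have "lcm_ratio k n powr r * (\<Prod>i=1..k. real (n i) powr r) = real (lcm_tuple k n) powr r"
      if "n \<in> tuples_upto k x" for n x
    proof -
      have "(\<Prod>i=1..k. n i) > 0" using pos[OF that] by (intro prod_pos) auto
      then have "real (lcm_tuple k n) = lcm_ratio k n * real (\<Prod>i=1..k. n i)"
        by (simp add: lcm_ratio_def)
      from arg_cong[OF this, of "\<lambda>y. y powr r"]
      have "real (lcm_tuple k n) powr r = lcm_ratio k n powr r * real (\<Prod>i=1..k. n i) powr r"
        by (subst (asm) powr_mult) (auto simp: lcm_ratio_def intro!: divide_nonneg_nonneg prod_nonneg)
      also have "real (\<Prod>i=1..k. n i) powr r = (\<Prod>i=1..k. real (n i) powr r)"
        by (simp add: prod_powr_distrib)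
      finally show ?thesis ..
    qed
    moreover have "(x powr (r + 1) / (r + 1)) ^ k = x powr (real k * (r + 1)) / (r + 1) ^ k" if "x > 0" for x
      using that by (simp add: power_divide powr_realpow [symmetric] powr_powr mult.commute)
    ultimately have "\<bar>(\<Sum>n\<in>tuples_upto k x. real (lcm_tuple k n) powr r)
             - C r k * (x powr (real k * (r + 1)) / (r + 1) ^ k)\<bar> \<le> K * x powr (real k * (r + 1) - saving r)"
      if "x > 0" for x
      using K[OF that] that by simp
    then show ?thesis by (rule bigo_powr_weaken[OF _ le])
  qed
  show "(\<lambda>x::real. (\<Sum>n\<in>tuples_upto k x.
               (real (lcm_tuple k n) / real (\<Prod>i=1..k. n i)) powr r)
             - C r k * x ^ k)
          \<in> O[at_top](\<lambda>x. x powr (real k - 1/2 * min (r + 1) 1 + \<epsilon>))"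
  proof -
    \<comment> \<open>The choice \<open>t = 0\<close> leaves the ratio unweighted and gives the main
      term \<open>C r k * x ^ k\<close>.\<close>
    have "saving r \<le> min (0 + 1) 1" using sv by simp
    then obtain K where K: "\<And>x. x > 0 \<Longrightarrow>
      \<bar>(\<Sum>n\<in>tuples_upto k x. lcm_ratio k n powr r * (\<Prod>i=1..k. real (n i) powr 0)) -
        C r k * (x powr (0 + 1) / (0 + 1)) ^ k\<bar> \<le> K * x powr (real k * (0 + 1) - saving r)"
      using lcm_sum_asymp[OF r, of 0 k] k by force
    have "lcm_ratio k n powr r * (\<Prod>i=1..k. real (n i) powr 0) = (real (lcm_tuple k n) / real (\<Prod>i=1..k. n i)) powr r"
      if "n \<in> tuples_upto k x" for n x
    proof -
      \<comment> \<open>Positivity of the entries matters here, since \<open>0 powr 0\<close> is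
        0.\<close>
      have "(\<Prod>i=1..k. real (n i) powr 0) = (\<Prod>i=1..k. 1)"
        using pos[OF that] by (intro prod.cong) auto
      then show ?thesis by (simp add: lcm_ratio_def)
    qed
    then have "\<bar>(\<Sum>n\<in>tuples_upto k x. (real (lcm_tuple k n) / real (\<Prod>i=1..k. n i)) powr r)
             - C r k * x ^ k\<bar> \<le> K * x powr (real k - saving r)"
      if "x > 0" for x
      using K[OF that] that by (simp cong: sum.cong)
    then show ?thesis by (rule bigo_powr_weaken[OF _ le])
  qed
qed (use prime_prod_factor3[OF assms(2)] prime_prod_factor4[OF assms(2)] in auto)

end
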